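(* Let $\mathcal L$ be a positive definite linear functional on $\prod^{N,M}$ and let $\{\Phi_{n,m}\}$, $\{\tilde\Phi_{n,m}\}$, $0\le n\le N$, $0\le m\le M$, be its vector orthonormal polynomials in the lexicographical and reverse lexicographical orderings (see context). Then the following recurrence formulas hold (the first two for $n\ge1$): $$A_{n,m}\Phi_{n,m}=z\Phi_{n-1,m}-\hat E_{n,m}\overleftarrow\Phi_{n-1,m}^T,$$ $$\Phi_{n,m}+A_{n,m}^\dagger\hat E_{n,m}(A_{n,m}^T)^{-1}\overleftarrow\Phi_{n,m}^T=A_{n,m}^\dagger z\Phi_{n-1,m},$$ $$\Gamma_{n,m}\Phi_{n,m}=\Phi_{n,m-1}-\mathcal K_{n,m}\tilde\Phi_{n-1,m},$$ $$\Gamma^1_{n,m}\Phi_{n,m}=w\Phi_{n,m-1}-\mathcal K^1_{n,m}\overleftarrow{\tilde\Phi}_{n-1,m}^T,$$ $$\Phi_{n,m}=I_{n,m}\tilde\Phi_{n,m}+\Gamma_{n,m}^\dagger\Phi_{n,m-1},$$ $$\overleftarrow\Phi_{n,m}^T=I^1_{n,m}\tilde\Phi_{n,m}+(\Gamma^1_{n,m})^T\overleftarrow\Phi_{n,m-1}^T,$$ where $$\hat E_{n,m}=\langle z\Phi_{n-1,m},\overleftarrow\Phi_{n-1,m}^T\rangle=E_{n,m}J_m=\hat E_{n,m}^T\in M^{m+1,m+1},\qquad A_{n,m}=\langle z\Phi_{n-1,m},\Phi_{n,m}\rangle\in M^{m+1,m+1},$$ $$\mathcal K_{n,m}=\langle\Phi_{n,m-1},\tilde\Phi_{n-1,m}\rangle\in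 M^{m,n},\qquad \Gamma_{n,m}=\langle\Phi_{n,m-1},\Phi_{n,m}\rangle\in M^{m,m+1},$$ $$\mathcal K^1_{n,m}=\langle w\Phi_{n,m-1},\overleftarrow{\tilde\Phi}_{n-1,m}^T\rangle\in M^{m,n},\qquad \Gamma^1_{n,m}=\langle w\Phi_{n,m-1},\Phi_{n,m}\rangle\in M^{m,m+1},$$ $$I_{n,m}=\langle\Phi_{n,m},\tilde\Phi_{n,m}\rangle\in M^{m+1,n+1},\qquad I^1_{n,m}=\langle\overleftarrow\Phi_{n,m}^T,\tilde\Phi_{n,m}\rangle\in M^{m+1,n+1}.$$ Similar formulas hold for $\tilde\Phi_{n,m}$, with the roles of the two orderings (and of $z,w$ and $n,m$) interchanged: (the first two for $m\ge1$) $$\tilde A_{n,m}\tilde\Phi_{n,m}=w\tilde\Phi_{n,m-1}-\hat{\tilde E}_{n,m}\overleftarrow{\tilde\Phi}_{n,m-1}^T,\qquad \tilde\Phi_{n,m}+\tilde A_{n,m}^\dagger\hat{\tilde E}_{n,m}(\tilde A_{n,m}^T)^{-1}\overleftarrow{\tilde\Phi}_{n,m}^T=\tilde A_{n,m}^\dagger w\tilde\Phi_{n,m-1},$$ $$\tilde\Gamma_{n,m}\tilde\Phi_{n,m}=\tilde\Phi_{n-1,m}-\tilde{\mathcal K}_{n,m}\Phi_{n,m-1},\qquad \tilde\Gamma^1_{n,m}\tilde\Phi_{n,m}=z\tilde\Phi_{n-1,m}-\tilde{\mathcal K}^1_{n,m}\overleftarrow\Phi_{n,m-1}^T,$$ $$\tilde\Phi_{n,m}=\tilde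 I_{n,m}\Phi_{n,m}+\tilde\Gamma_{n,m}^\dagger\tilde\Phi_{n-1,m},\qquad \overleftarrow{\tilde\Phi}_{n,m}^T=\tilde I^1_{n,m}\Phi_{n,m}+(\tilde\Gamma^1_{n,m})^T\overleftarrow{\tilde\Phi}_{n-1,m}^T,$$ where $\hat{\tilde E}_{n,m}=\langle w\tilde\Phi_{n,m-1},\overleftarrow{\tilde\Phi}_{n,m-1}^T\rangle=\hat{\tilde E}_{n,m}^T$, $\tilde A_{n,m}=\langle w\tilde\Phi_{n,m-1},\tilde\Phi_{n,m}\rangle$, $\tilde{\mathcal K}_{n,m}=\langle\tilde\Phi_{n-1,m},\Phi_{n,m-1}\rangle$, $\tilde\Gamma_{n,m}=\langle\tilde\Phi_{n-1,m},\tilde\Phi_{n,m}\rangle$, $\tilde{\mathcal K}^1_{n,m}=\langle z\tilde\Phi_{n-1,m},\overleftarrow\Phi_{n,m-1}^T\rangle$, $\tilde\Gamma^1_{n,m}=\langle z\tilde\Phi_{n-1,m},\tilde\Phi_{n,m}\rangle$, $\tilde I_{n,m}=\langle\tilde\Phi_{n,m},\Phi_{n,m}\rangle$, $\tilde I^1_{n,m}=\langle\overleftarrow{\tilde\Phi}_{n,m}^T,\Phi_{n,m}\rangle$.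
   Context: $\prod^{N,M}=\mathrm{span}\{z^iw^j:|i|\le N,|j|\le M\}$, $\hat\prod^{N,M}=\mathrm{span}\{z^iw^j:0\le i\le N,0\le j\le M\}$. For a (matrix valued) Laurent polynomial $Q$, $Q^\dagger(z,w)=Q(1/\bar z,1/\bar w)^\dagger$. A linear functional $\mathcal L$ on $\prod^{N,M}$ with $\mathcal L(z^{-i}w^{-j})=\overline{\mathcal L(z^iw^j)}$ is positive definite if $\mathcal L(pp^\dagger)>0$ for all nonzero $p\in\hat\prod^{N,M}$. It is applied entrywise and, for column vectors, $\langle X,Y\rangle=\mathcal L(XY^\dagger)$. $M^{k,l}$ is the space of complex $k\times l$ matrices. For $0\le l\le m$, $\phi^l_{n,m}$ is the unique element of $\mathrm{span}(\{z^iw^j:0\le i<n,0\le j\le m\}\cup\{z^nw^j:0\le j\le l\})$ with positive coefficient of $z^nw^l$, $\langle\phi^l_{n,m},\phi^l_{n,m}\rangle=1$, orthogonal to all of these monomials except $z^nw^l$; $\Phi_{n,m}=[\phi^m_{n,m},\dots,\phi^0_{n,m}]^T$. For $0\le l\le n$, $\tilde\phi^l_{n,m}$ is the unique element of $\mathrm{span}(\{z^iw^j:0\le i\le n,0\le j<m\}\cup\{z^iw^m:0\le i\le l\})$ with positive coefficient of $z^lw^m$, norm one, orthogonal to all of these monomials except $z^lw^m$; $\tilde\Phi_{n,m}=[\tilde\phi^n_{n,m},\dots,\tilde\phi^0_{n,m}]^T$. Reversals are the row vectors $\overleftarrow\Phi_{n,m}(z,w)=z^nw^m\Phi_{n,m}(1/\bar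 z,1/\bar w)^\dagger$, $\overleftarrow{\tilde\Phi}_{n,m}(z,w)=z^nw^m\tilde\Phi_{n,m}(1/\bar z,1/\bar w)^\dagger$. Convention: $\Phi_{n,-1}$ and $\tilde\Phi_{-1,m}$ are empty, and matrices with zero rows or columns are empty (products over an empty index are zero). $J_m$ is the $(m+1)\times(m+1)$ matrix with ones on the antidiagonal and zeros elsewhere. $E_{n,m}$ is the matrix recurrence coefficient: write $\Phi_{n,m}=L^m_n(z)v(w)$ with $v(w)=[w^m,w^{m-1},\dots,1]^T$ and $L^m_n$ a matrix polynomial in $z$ of degree $n$, $R^m_n(z)=J_mL^m_n(z)^TJ_m$, $\overleftarrow R^m_n(z)=z^nR^m_n(1/\bar z)^\dagger$; then $E_{n,m}=\langle zL^m_{n-1}(z)v(w),\ \overleftarrow R^m_{n-1}(z)v(w)\rangle$. *)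

theory Defs
  imports
    "HOL-Library.Poly_Mapping"
    "HOL-Library.Product_Plus"
    "HOL-Library.Complex_Order"
    "Jordan_Normal_Form.Matrix"
    "Jordan_Normal_Form.Gauss_Jordan_Elimination"
    "Jordan_Normal_Form.Schur_Decomposition"
begin

text \<open>
  A Laurent polynomial is its finitely supported coefficient function: the value at \<open>(i, j)\<close> is
  the coefficient of \<open>z\<^sup>i w\<^sup>j\<close>. The library's ring structure (convolution along the componentwise
  addition of exponents) is multiplication of Laurent polynomials.
\<close>

type_synonym laurent = "(int \<times> int) \<Rightarrow>\<^sub>0 complex"

definition lmonom :: "int \<Rightarrow> int \<Rightarrow> laurent" where
  "lmonom i j = Poly_Mapping.single (i, j) 1"

abbreviation zvar :: laurent where "zvar \<equiv> lmonom 1 0"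
abbreviation wvar :: laurent where "wvar \<equiv> lmonom 0 1"

definition lconst :: "complex \<Rightarrow> laurent" where
  "lconst c = Poly_Mapping.single (0, 0) c"

definition lscale :: "complex \<Rightarrow> laurent \<Rightarrow> laurent" where
  "lscale c p = lconst c * p"

global_interpretation laurent: vector_space lscale
proof
  have zero: "(0, 0) = (0 :: int \<times> int)"
    by (simp add: zero_prod_def)
  fix a b :: complex and x y :: laurent
  show "lscale a (x + y) = lscale a x + lscale a y"
    by (simp add: lscale_def distrib_left)
  show "lscale (a + b) x = lscale a x + lscale b x"
    by (simp add: lscale_def lconst_def single_add distrib_right)
  show "lscale a (lscale b x) = lscale (a * b) x"
    by (simp add: lscale_def lconst_def mult_single mult.assoc [symmetric])
  show "lscale 1 x = x"
    by (simp add: lscale_def lconst_def zero)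
qed

definition lspan :: "(int \<times> int) set \<Rightarrow> laurent set" where
  "lspan S = laurent.span ((\<lambda>(i, j). lmonom i j) ` S)"

definition Pi_sp :: "nat \<Rightarrow> nat \<Rightarrow> laurent set" where
  "Pi_sp N M = lspan {(i, j). \<bar>i\<bar> \<le> int N \<and> \<bar>j\<bar> \<le> int M}"

definition Pi_hat :: "nat \<Rightarrow> nat \<Rightarrow> laurent set" where
  "Pi_hat N M = lspan {(i, j). 0 \<le> i \<and> i \<le> int N \<and> 0 \<le> j \<and> j \<le> int M}"

text \<open>
  For \<open>p = \<Sum> p\<^sub>i\<^sub>j z\<^sup>i w\<^sup>j\<close>, the conjugate of \<open>p\<close> at the conjugate-reciprocal point
  is \<open>\<Sum> (cnj p\<^sub>i\<^sub>j) z\<^sup>-\<^sup>i w\<^sup>-\<^sup>j\<close>.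
\<close>

definition ldag :: "laurent \<Rightarrow> laurent" where
  "ldag p = (\<Sum>(i, j) \<in> Poly_Mapping.keys p.
      lscale (cnj (Poly_Mapping.lookup p (i, j))) (lmonom (- i) (- j)))"

definition mdag :: "laurent mat \<Rightarrow> laurent mat" where
  "mdag Q = map_mat ldag (Q\<^sup>T)"

abbreviation cmat :: "complex mat \<Rightarrow> laurent mat" where
  "cmat A \<equiv> map_mat lconst A"

text \<open>
  A functional on a subspace is a total function of which only the values on that subspace matter.
  The order on \<^typ>\<open>complex\<close> is the one of \<^theory>\<open>HOL-Library.Complex_Order\<close>: \<open>0 < c\<close> says
  that \<open>c\<close> is real and positive.
\<close>

definition linear_functional_on :: "laurent set \<Rightarrow> (laurent \<Rightarrow> complex) \<Rightarrow> bool" where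
  "linear_functional_on V L \<longleftrightarrow>
     (\<forall>p \<in> V. \<forall>q \<in> V. L (p + q) = L p + L q) \<and>
     (\<forall>c. \<forall>p \<in> V. L (lscale c p) = c * L p)"

definition pos_def_functional :: "nat \<Rightarrow> nat \<Rightarrow> (laurent \<Rightarrow> complex) \<Rightarrow> bool" where
  "pos_def_functional N M L \<longleftrightarrow>
     linear_functional_on (Pi_sp N M) L \<and>
     (\<forall>i j. \<bar>i\<bar> \<le> int N \<and> \<bar>j\<bar> \<le> int M \<longrightarrow> L (lmonom (- i) (- j)) = cnj (L (lmonom i j))) \<and>
     (\<forall>p \<in> Pi_hat N M. p \<noteq> 0 \<longrightarrow> 0 < L (p * ldag p))"

definition ip :: "(laurent \<Rightarrow> complex) \<Rightarrow> laurent \<Rightarrow> laurent \<Rightarrow> complex" where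
  "ip L p q = L (p * ldag q)"

definition mip :: "(laurent \<Rightarrow> complex) \<Rightarrow> laurent mat \<Rightarrow> laurent mat \<Rightarrow> complex mat" where
  "mip L X Y = map_mat L (X * mdag Y)"

text \<open>
  The degrees \<open>n\<close>, \<open>m\<close> are integers so that the empty vectors of index \<open>-1\<close> need no special
  treatment: a vector of index \<open>-1\<close> has \<open>nat (-1 + 1) = 0\<close> rows. The suffix \<open>_t\<close> marks the objects with a tilde
  (reverse lexicographical ordering).
\<close>

definition is_onp :: "(laurent \<Rightarrow> complex) \<Rightarrow> (int \<times> int) set \<Rightarrow> int \<times> int \<Rightarrow> laurent \<Rightarrow> bool" where
  "is_onp L S k p \<longleftrightarrow>
     p \<in> lspan S \<and> 0 < Poly_Mapping.lookup p k \<and> ip L p p = 1 \<and>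
     (\<forall>(i, j) \<in> S - {k}. ip L p (lmonom i j) = 0)"

definition phi :: "(laurent \<Rightarrow> complex) \<Rightarrow> int \<Rightarrow> int \<Rightarrow> int \<Rightarrow> laurent" where
  "phi L n m l = (THE p. is_onp L
     ({(i, j). 0 \<le> i \<and> i < n \<and> 0 \<le> j \<and> j \<le> m} \<union> {(i, j). i = n \<and> 0 \<le> j \<and> j \<le> l}) (n, l) p)"

definition phi_t :: "(laurent \<Rightarrow> complex) \<Rightarrow> int \<Rightarrow> int \<Rightarrow> int \<Rightarrow> laurent" where
  "phi_t L n m l = (THE p. is_onp L
     ({(i, j). 0 \<le> i \<and> i \<le> n \<and> 0 \<le> j \<and> j < m} \<union> {(i, j). 0 \<le> i \<and> i \<le> l \<and> j = m}) (l, m) p)"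

definition Phi :: "(laurent \<Rightarrow> complex) \<Rightarrow> int \<Rightarrow> int \<Rightarrow> laurent mat" where
  "Phi L n m = mat (nat (m + 1)) 1 (\<lambda>(r, _). phi L n m (m - int r))"

definition Phi_t :: "(laurent \<Rightarrow> complex) \<Rightarrow> int \<Rightarrow> int \<Rightarrow> laurent mat" where
  "Phi_t L n m = mat (nat (n + 1)) 1 (\<lambda>(r, _). phi_t L n m (n - int r))"

definition Phi_rev :: "(laurent \<Rightarrow> complex) \<Rightarrow> int \<Rightarrow> int \<Rightarrow> laurent mat" where
  "Phi_rev L n m = lmonom n m \<cdot>\<^sub>m mdag (Phi L n m)"

definition Phi_t_rev :: "(laurent \<Rightarrow> complex) \<Rightarrow> int \<Rightarrow> int \<Rightarrow> laurent mat" where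
  "Phi_t_rev L n m = lmonom n m \<cdot>\<^sub>m mdag (Phi_t L n m)"

definition J_mat :: "int \<Rightarrow> complex mat" where
  "J_mat m = mat (nat (m + 1)) (nat (m + 1)) (\<lambda>(r, c). if int r + int c = m then 1 else 0)"

definition v_col :: "int \<Rightarrow> laurent mat" where
  "v_col m = mat (nat (m + 1)) 1 (\<lambda>(r, _). lmonom 0 (m - int r))"

text \<open>
  The coefficient matrix \<open>L\<^sup>m\<^sub>n(z)\<close> of \<open>\<Phi>\<^sub>n\<^sub>,\<^sub>m = L\<^sup>m\<^sub>n(z) v(w)\<close>: column \<open>c\<close> carries the coefficients
  of \<open>w\<^sup>m\<^sup>-\<^sup>c\<close>, which are polynomials in \<open>z\<close> of degree at most \<open>n\<close>.
\<close>

definition Lmat :: "(laurent \<Rightarrow> complex) \<Rightarrow> int \<Rightarrow> int \<Rightarrow> laurent mat" where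
  "Lmat L n m = mat (nat (m + 1)) (nat (m + 1)) (\<lambda>(r, c).
     \<Sum>i = 0..n. lscale (Poly_Mapping.lookup (Phi L n m $$ (r, 0)) (i, m - int c)) (lmonom i 0))"

definition Rmat :: "(laurent \<Rightarrow> complex) \<Rightarrow> int \<Rightarrow> int \<Rightarrow> laurent mat" where
  "Rmat L n m = cmat (J_mat m) * (Lmat L n m)\<^sup>T * cmat (J_mat m)"

definition Rmat_rev :: "(laurent \<Rightarrow> complex) \<Rightarrow> int \<Rightarrow> int \<Rightarrow> laurent mat" where
  "Rmat_rev L n m = lmonom n 0 \<cdot>\<^sub>m mdag (Rmat L n m)"

definition E_coef :: "(laurent \<Rightarrow> complex) \<Rightarrow> int \<Rightarrow> int \<Rightarrow> complex mat" where
  "E_coef L n m = mip L (zvar \<cdot>\<^sub>m (Lmat L (n - 1) m * v_col m)) (Rmat_rev L (n - 1) m * v_col m)"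

definition E_hat :: "(laurent \<Rightarrow> complex) \<Rightarrow> int \<Rightarrow> int \<Rightarrow> complex mat" where
  "E_hat L n m = mip L (zvar \<cdot>\<^sub>m Phi L (n - 1) m) ((Phi_rev L (n - 1) m)\<^sup>T)"

definition A_coef :: "(laurent \<Rightarrow> complex) \<Rightarrow> int \<Rightarrow> int \<Rightarrow> complex mat" where
  "A_coef L n m = mip L (zvar \<cdot>\<^sub>m Phi L (n - 1) m) (Phi L n m)"

definition K_coef :: "(laurent \<Rightarrow> complex) \<Rightarrow> int \<Rightarrow> int \<Rightarrow> complex mat" where
  "K_coef L n m = mip L (Phi L n (m - 1)) (Phi_t L (n - 1) m)"

definition Gam_coef :: "(laurent \<Rightarrow> complex) \<Rightarrow> int \<Rightarrow> int \<Rightarrow> complex mat" where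
  "Gam_coef L n m = mip L (Phi L n (m - 1)) (Phi L n m)"

definition K1_coef :: "(laurent \<Rightarrow> complex) \<Rightarrow> int \<Rightarrow> int \<Rightarrow> complex mat" where
  "K1_coef L n m = mip L (wvar \<cdot>\<^sub>m Phi L n (m - 1)) ((Phi_t_rev L (n - 1) m)\<^sup>T)"

definition Gam1_coef :: "(laurent \<Rightarrow> complex) \<Rightarrow> int \<Rightarrow> int \<Rightarrow> complex mat" where
  "Gam1_coef L n m = mip L (wvar \<cdot>\<^sub>m Phi L n (m - 1)) (Phi L n m)"

definition I_coef :: "(laurent \<Rightarrow> complex) \<Rightarrow> int \<Rightarrow> int \<Rightarrow> complex mat" where
  "I_coef L n m = mip L (Phi L n m) (Phi_t L n m)"

definition I1_coef :: "(laurent \<Rightarrow> complex) \<Rightarrow> int \<Rightarrow> int \<Rightarrow> complex mat" where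
  "I1_coef L n m = mip L ((Phi_rev L n m)\<^sup>T) (Phi_t L n m)"

definition E_hat_t :: "(laurent \<Rightarrow> complex) \<Rightarrow> int \<Rightarrow> int \<Rightarrow> complex mat" where
  "E_hat_t L n m = mip L (wvar \<cdot>\<^sub>m Phi_t L n (m - 1)) ((Phi_t_rev L n (m - 1))\<^sup>T)"

definition A_coef_t :: "(laurent \<Rightarrow> complex) \<Rightarrow> int \<Rightarrow> int \<Rightarrow> complex mat" where
  "A_coef_t L n m = mip L (wvar \<cdot>\<^sub>m Phi_t L n (m - 1)) (Phi_t L n m)"

definition K_coef_t :: "(laurent \<Rightarrow> complex) \<Rightarrow> int \<Rightarrow> int \<Rightarrow> complex mat" where
  "K_coef_t L n m = mip L (Phi_t L (n - 1) m) (Phi L n (m - 1))"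

definition Gam_coef_t :: "(laurent \<Rightarrow> complex) \<Rightarrow> int \<Rightarrow> int \<Rightarrow> complex mat" where
  "Gam_coef_t L n m = mip L (Phi_t L (n - 1) m) (Phi_t L n m)"

definition K1_coef_t :: "(laurent \<Rightarrow> complex) \<Rightarrow> int \<Rightarrow> int \<Rightarrow> complex mat" where
  "K1_coef_t L n m = mip L (zvar \<cdot>\<^sub>m Phi_t L (n - 1) m) ((Phi_rev L n (m - 1))\<^sup>T)"

definition Gam1_coef_t :: "(laurent \<Rightarrow> complex) \<Rightarrow> int \<Rightarrow> int \<Rightarrow> complex mat" where
  "Gam1_coef_t L n m = mip L (zvar \<cdot>\<^sub>m Phi_t L (n - 1) m) (Phi_t L n m)"

definition I_coef_t :: "(laurent \<Rightarrow> complex) \<Rightarrow> int \<Rightarrow> int \<Rightarrow> complex mat" where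
  "I_coef_t L n m = mip L (Phi_t L n m) (Phi L n m)"

definition I1_coef_t :: "(laurent \<Rightarrow> complex) \<Rightarrow> int \<Rightarrow> int \<Rightarrow> complex mat" where
  "I1_coef_t L n m = mip L ((Phi_t_rev L n m)\<^sup>T) (Phi L n m)"

text \<open>
  \<^const>\<open>mat_inverse\<close> returns an option; the inverse proper is only meaningful for
  invertible matrices.
\<close>

abbreviation minv :: "complex mat \<Rightarrow> complex mat" where
  "minv B \<equiv> the (mat_inverse B)"

end

(*
  A vector Phi(n,m) is an orthonormal basis of the orthogonal complement of span(n-1,m) in
  span(n,m); reversing it, or multiplying it by a monomial, gives an orthonormal basis of the
  complement of a correspondingly reflected or translated box. In each recurrence the left-hand side
  lies in span(n,m) and is orthogonal to the monomials of a smaller box T, and the two vectors on the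
  right are mutually orthogonal orthonormal families with the same property whose sizes add up to the
  codimension of T. Hence the recurrence is an orthonormal expansion. In the second formula
  the coefficient of the reversed vector comes from Parseval's identity, and A is invertible because it
  is triangular with nonzero diagonal. The formulas with tildes result from interchanging z and w.
*)

theory Submission
  imports Defs "Jordan_Normal_Form.Determinant"
begin

section \<open>Laurent polynomials\<close>

text \<open>\<open>L\<close> is linear only on \<open>Pi_sp N M\<close>, which is just large enough
  for products \<open>p * ldag q\<close> with \<open>p\<close> and \<open>q\<close> in
  \<open>Pi_hat N M\<close>. Hence every vector carries a box containing its supports and a box
  whose monomials it annihilates (\<open>colvec\<close>); shifts translate both boxes and reversals
  reflect them. Mutual orthogonality of two vectors then reduces to inclusion of the support box of
  one in the annihilated box of the other. In the formulas mixing both orderings the small box has n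
  times m points, so its codimension (n+1)(m+1) - nm = (m+1) + n = (n+1) + m fits one vector of each
  ordering. In the recurrences in n alone it is \<open>box 1 (n - 1) 0 m\<close>, of codimension
  2(m+1) for n >= 1. Its complement has two orthonormal bases: Phi(n,m) with the reversed
  Phi(n-1,m), used to expand z Phi(n-1,m), and z Phi(n-1,m) with the reversed Phi(n,m), used to
  expand Phi(n,m). Reversal is antilinear and exchanges the arguments of the inner product; this is
  the source of the plain transposes that stand beside the adjoints.\<close>

abbreviation (input) lk :: "laurent \<Rightarrow> int \<times> int \<Rightarrow> complex" where
  "lk \<equiv> Poly_Mapping.lookup"

abbreviation (input) ks :: "laurent \<Rightarrow> (int \<times> int) set" where
  "ks \<equiv> Poly_Mapping.keys"

lemma laurent_decomp: "p = (\<Sum>k \<in> ks p. Poly_Mapping.single k (lk p k))" for p :: laurent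
  by (rule poly_mapping_eqI)
    (auto simp: lookup_sum lookup_single when_def sum.delta in_keys_iff)

lemma laurent_induct [case_names zero add]:
  fixes p :: laurent
  assumes "P 0" and "\<And>k c p. P p \<Longrightarrow> P (Poly_Mapping.single k c + p)"
  shows "P p"
proof -
  have "P (\<Sum>k \<in> A. Poly_Mapping.single k (lk p k))" if "finite A" for A
    using that by (induction A) (auto intro: assms)
  from this[of "ks p"] show ?thesis
    by (simp flip: laurent_decomp)
qed

text \<open>Both factors are sums of single terms, so additivity reduces multiplicativity to
  products of two terms. It serves \<open>ldag\<close> and \<open>lswap\<close>.\<close>

lemma additive_mult:
  fixes f :: "laurent \<Rightarrow> laurent"
  assumes f0: "f 0 = 0" and add: "\<And>p q. f (p + q) = f p + f q"
    and single: "\<And>a b c d. f (Poly_Mapping.single a c * Poly_Mapping.single b d)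
      = f (Poly_Mapping.single a c) * f (Poly_Mapping.single b d)"
  shows "f (p * q) = f p * f q"
proof (induction p rule: laurent_induct)
  case zero
  then show ?case by (simp add: f0)
next
  case (add k c p)
  have "f (Poly_Mapping.single k c * q) = f (Poly_Mapping.single k c) * f q"
    by (induction q rule: laurent_induct) (simp_all add: f0 assms(2) single distrib_left)
  with add show ?case
    by (simp add: assms(2) distrib_right)
qed

lemma lookup_single_mult:
  fixes p :: laurent
  shows "lk (Poly_Mapping.single a c * p) k = c * lk p (k - a)"
  by (induction p rule: laurent_induct)
    (auto simp: distrib_left mult_single lookup_add lookup_single when_def)

lemma lookup_lscale [simp]: "lk (lscale c p) k = c * lk p k"
  by (simp add: lscale_def lconst_def lookup_single_mult flip: zero_prod_def)

lemma lookup_lmonom: "lk (lmonom i j) k = (if k = (i, j) then 1 else 0)"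
  by (simp add: lmonom_def lookup_single when_def)

lemma lookup_lmonom_mult [simp]: "lk (lmonom i j * p) k = lk p (k - (i, j))"
  by (simp add: lmonom_def lookup_single_mult)

lemma lscale_lmonom: "lscale c (lmonom i j) = Poly_Mapping.single (i, j) c"
  by (rule poly_mapping_eqI) (simp add: lookup_lmonom lookup_single when_def)

lemma lmonom_mult: "lmonom a b * lmonom c d = lmonom (a + c) (b + d)"
  by (simp add: lmonom_def mult_single)

lemma lmonom_0 [simp]: "lmonom 0 0 = 1"
  by (simp add: lmonom_def flip: zero_prod_def)

lemma lookup_ldag [simp]: "lk (ldag p) k = cnj (lk p (- k))"
proof -
  have "lk (ldag p) k = (\<Sum>a \<in> ks p. if a = - k then cnj (lk p a) else 0)"
    unfolding ldag_def lookup_sum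
    by (intro sum.cong)
      (auto simp: lookup_lmonom minus_equation_iff[of k] eq_commute[of k] split: prod.splits)
  also have "\<dots> = cnj (lk p (- k))"
    by (simp add: sum.delta in_keys_iff)
  finally show ?thesis .
qed

lemma ldag_0 [simp]: "ldag 0 = 0"
  by (rule poly_mapping_eqI) simp

lemma ldag_add: "ldag (p + q) = ldag p + ldag q"
  by (rule poly_mapping_eqI) (simp add: lookup_add)

lemma ldag_lscale: "ldag (lscale c p) = lscale (cnj c) (ldag p)"
  by (rule poly_mapping_eqI) simp

lemma ldag_single: "ldag (Poly_Mapping.single k c) = Poly_Mapping.single (- k) (cnj c)"
  by (rule poly_mapping_eqI) (auto simp: lookup_single when_def minus_equation_iff[of k])

lemma ldag_lmonom [simp]: "ldag (lmonom i j) = lmonom (- i) (- j)"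
  by (simp add: lmonom_def ldag_single)

lemma ldag_ldag [simp]: "ldag (ldag p) = p"
  by (rule poly_mapping_eqI) simp

lemma ldag_mult: "ldag (p * q) = ldag p * ldag q"
  by (rule additive_mult) (simp_all add: ldag_add mult_single ldag_single)

lemma keys_ldag: "ks (ldag p) = uminus ` ks p"
proof -
  have "k \<in> ks (ldag p) \<longleftrightarrow> - k \<in> ks p" for k
    by (simp add: in_keys_iff)
  then show ?thesis
    by (force simp: image_iff)
qed

lemma keys_lmonom [simp]: "ks (lmonom i j) = {(i, j)}"
  by (simp add: lmonom_def)

lemma lmonom_eq_iff [simp]: "lmonom i j = lmonom k l \<longleftrightarrow> i = k \<and> j = l"
  by (metis keys_lmonom prod.inject singleton_inject)

lemma keys_lmonom_mult: "ks (lmonom i j * p) = (\<lambda>k. k + (i, j)) ` ks p"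
proof -
  have "k \<in> ks (lmonom i j * p) \<longleftrightarrow> k - (i, j) \<in> ks p" for k
    by (simp add: in_keys_iff)
  then show ?thesis
    by (force simp: image_iff)
qed

lemma keys_lscale: "ks (lscale c p) \<subseteq> ks p"
  by (auto simp: in_keys_iff)

lemma keys_plus_subset: "ks p \<subseteq> S \<Longrightarrow> ks q \<subseteq> S \<Longrightarrow> ks (p + q) \<subseteq> S" for p q :: laurent
  using keys_add[of p q] by blast

lemma keys_minus_subset: "ks p \<subseteq> S \<Longrightarrow> ks q \<subseteq> S \<Longrightarrow> ks (p - q) \<subseteq> S" for p q :: laurent
  by (auto simp: in_keys_iff lookup_minus subset_iff) (metis diff_0)

lemma keys_lscale_subset: "ks p \<subseteq> S \<Longrightarrow> ks (lscale c p) \<subseteq> S"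
  using keys_lscale[of c p] by blast

lemma keys_sum_subset:
  "(\<And>a. a \<in> A \<Longrightarrow> ks (f a) \<subseteq> S) \<Longrightarrow> ks (sum f A) \<subseteq> S" for f :: "'a \<Rightarrow> laurent"
proof (induction A rule: infinite_finite_induct)
  case (insert x F)
  then show ?case by (simp add: keys_plus_subset)
qed auto

text \<open>Turns every span into a condition on supports; from here on only sets of exponents are
  compared.\<close>

lemma lspan_iff: "p \<in> lspan S \<longleftrightarrow> ks p \<subseteq> S"
proof
  assume "p \<in> lspan S"
  then show "ks p \<subseteq> S"
    unfolding lspan_def
  proof (induction rule: laurent.span_induct_alt)
    case (step c x y)
    then show ?case
      by (intro keys_plus_subset keys_lscale_subset) auto
  qed simp
next
  assume S: "ks p \<subseteq> S"
  have "(\<Sum>k \<in> ks p. Poly_Mapping.single k (lk p k)) \<in> lspan S"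
    unfolding lspan_def
  proof (rule laurent.span_sum)
    fix k assume "k \<in> ks p"
    moreover obtain i j where k: "k = (i, j)"
      by (cases k)
    ultimately have "lmonom i j \<in> (\<lambda>(i, j). lmonom i j) ` S"
      using S by force
    then have "lscale (lk p k) (lmonom i j) \<in> laurent.span ((\<lambda>(i, j). lmonom i j) ` S)"
      by (intro laurent.span_scale laurent.span_base)
    then show "Poly_Mapping.single k (lk p k) \<in> laurent.span ((\<lambda>(i, j). lmonom i j) ` S)"
      by (simp add: k lscale_lmonom)
  qed
  then show "p \<in> lspan S"
    using laurent_decomp[of p] by simp
qed

section \<open>The inner product\<close>

text \<open>The monomial cancels against its own dagger, so \<open>L\<close> is applied to the same
  polynomial on both sides.\<close>

lemma ip_shift: "ip L (lmonom a b * p) (lmonom a b * q) = ip L p q"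
proof -
  have "lmonom a b * p * (lmonom (- a) (- b) * ldag q) = (lmonom a b * lmonom (- a) (- b)) * (p * ldag q)"
    by (simp only: ac_simps)
  then show ?thesis
    by (simp add: ip_def ldag_mult lmonom_mult)
qed

definition lrev :: "int \<Rightarrow> int \<Rightarrow> laurent \<Rightarrow> laurent" where
  "lrev n m p = lmonom n m * ldag p"

text \<open>Exchanged arguments are used in place of a conjugate because Hermitian symmetry of
  \<open>L\<close> is available only for supports inside the domain
  (\<open>ip_commute\<close>).\<close>

lemma ip_lrev: "ip L (lrev n m p) (lrev n m q) = ip L q p"
  unfolding lrev_def ip_shift by (simp add: ip_def mult.commute)

lemma lrev_lmonom: "lrev n m (lmonom i j) = lmonom (n - i) (m - j)"
  by (simp add: lrev_def lmonom_mult)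

section \<open>Boxes of exponents and orthogonality to their monomials\<close>

definition box :: "int \<Rightarrow> int \<Rightarrow> int \<Rightarrow> int \<Rightarrow> (int \<times> int) set" where
  "box a b c d = {a..b} \<times> {c..d}"

lemma mem_box [simp]: "(i, j) \<in> box a b c d \<longleftrightarrow> a \<le> i \<and> i \<le> b \<and> c \<le> j \<and> j \<le> d"
  by (auto simp: box_def)

lemma finite_box [simp]: "finite (box a b c d)"
  by (simp add: box_def)

lemma card_box: "card (box a b c d) = nat (b - a + 1) * nat (d - c + 1)"
  by (simp add: box_def algebra_simps)

lemma box_mono: "a' \<le> a \<Longrightarrow> b \<le> b' \<Longrightarrow> c' \<le> c \<Longrightarrow> d \<le> d' \<Longrightarrow> box a b c d \<subseteq> box a' b' c' d'"
  by (auto simp: box_def)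

text \<open>Reversal is the point reflection of exponents (i, j) to (n - i, m - j), which exchanges
  lower and upper bounds.\<close>

lemma keys_lrev_box:
  assumes "ks p \<subseteq> box a b c d"
  shows "ks (lrev n m p) \<subseteq> box (n - b) (n - a) (m - d) (m - c)"
  using assms by (force simp: lrev_def keys_lmonom_mult keys_ldag)

lemma keys_shift_box:
  assumes "ks p \<subseteq> box a b c d"
  shows "ks (lmonom i j * p) \<subseteq> box (a + i) (b + i) (c + j) (d + j)"
  using assms by (force simp: keys_lmonom_mult)

definition perp :: "(laurent \<Rightarrow> complex) \<Rightarrow> laurent \<Rightarrow> (int \<times> int) set \<Rightarrow> bool" where
  "perp L p T \<longleftrightarrow> (\<forall>(i, j) \<in> T. ip L p (lmonom i j) = 0)"

lemma perpD: "perp L p T \<Longrightarrow> (i, j) \<in> T \<Longrightarrow> ip L p (lmonom i j) = 0"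
  by (auto simp: perp_def)

lemma perp_subset: "perp L p T \<Longrightarrow> T' \<subseteq> T \<Longrightarrow> perp L p T'"
  by (auto simp: perp_def)

lemma perp_shift:
  assumes "perp L p (box a b c d)"
  shows "perp L (lmonom i j * p) (box (a + i) (b + i) (c + j) (d + j))"
proof -
  have "ip L (lmonom i j * p) (lmonom k l) = ip L p (lmonom (k - i) (l - j))" for k l
    using ip_shift[of L i j p "lmonom (k - i) (l - j)"] by (simp add: lmonom_mult)
  moreover have "ip L p (lmonom (k - i) (l - j)) = 0"
    if "(k, l) \<in> box (a + i) (b + i) (c + j) (d + j)" for k l
    using assms[unfolded perp_def, THEN bspec, of "(k - i, l - j)"] that by simp
  ultimately show ?thesis
    by (auto simp: perp_def)
qed

section \<open>Sesquilinearity and positivity of the inner product\<close>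

locale pos_def_form =
  fixes N M :: nat and L :: "laurent \<Rightarrow> complex"
  assumes pos_def: "pos_def_functional N M L"
begin

text \<open>Supports of the arguments of \<open>ip\<close> stay in \<open>D\<close>, so that the
  products handed to \<open>L\<close> stay in \<open>D2\<close>, where \<open>L\<close> is linear
  (\<open>keys_ip\<close>).\<close>

definition D :: "(int \<times> int) set" where
  "D = box 0 (int N) 0 (int M)"

definition D2 :: "(int \<times> int) set" where
  "D2 = box (- int N) (int N) (- int M) (int M)"

lemma Pi_sp_iff: "p \<in> Pi_sp N M \<longleftrightarrow> ks p \<subseteq> D2"
proof -
  have "{(i, j). \<bar>i\<bar> \<le> int N \<and> \<bar>j\<bar> \<le> int M} = D2"
    by (auto simp: D2_def)
  then show ?thesis
    by (simp add: Pi_sp_def lspan_iff)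
qed

lemma Pi_hat_iff: "p \<in> Pi_hat N M \<longleftrightarrow> ks p \<subseteq> D"
proof -
  have "{(i, j). 0 \<le> i \<and> i \<le> int N \<and> 0 \<le> j \<and> j \<le> int M} = D"
    by (auto simp: D_def)
  then show ?thesis
    by (simp add: Pi_hat_def lspan_iff)
qed

lemma L_add: "ks p \<subseteq> D2 \<Longrightarrow> ks q \<subseteq> D2 \<Longrightarrow> L (p + q) = L p + L q"
  and L_lscale: "ks p \<subseteq> D2 \<Longrightarrow> L (lscale c p) = c * L p"
  using pos_def by (auto simp: pos_def_functional_def linear_functional_on_def Pi_sp_iff)

lemma L_0 [simp]: "L 0 = 0"
  using L_lscale[of 0 0] by simp

lemma keys_ip: "ks p \<subseteq> D \<Longrightarrow> ks q \<subseteq> D \<Longrightarrow> ks (p * ldag q) \<subseteq> D2"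
  using keys_mult[of p "ldag q"] by (force simp: keys_ldag D_def D2_def)

lemma ip_add_left: "ks p \<subseteq> D \<Longrightarrow> ks p' \<subseteq> D \<Longrightarrow> ks q \<subseteq> D \<Longrightarrow> ip L (p + p') q = ip L p q + ip L p' q"
  by (simp add: ip_def distrib_right L_add keys_ip)

lemma ip_lscale_left: "ks p \<subseteq> D \<Longrightarrow> ks q \<subseteq> D \<Longrightarrow> ip L (lscale c p) q = c * ip L p q"
  using L_lscale[OF keys_ip, of p q c] by (simp add: ip_def lscale_def mult.assoc)

lemma ip_0_left [simp]: "ip L 0 q = 0"
  by (simp add: ip_def)

text \<open>The symmetry is assumed for monomials only. Induction over finite parts of the support
  extends it; all partial sums and their daggers stay in \<open>D2\<close>, which is symmetric under
  negation.\<close>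

lemma L_ldag:
  assumes "ks p \<subseteq> D2"
  shows "L (ldag p) = cnj (L p)"
proof -
  have "L (ldag (\<Sum>k \<in> A. Poly_Mapping.single k (lk p k)))
      = cnj (L (\<Sum>k \<in> A. Poly_Mapping.single k (lk p k)))" if "finite A" "A \<subseteq> D2" for A
    using that
  proof (induction A)
    case (insert k A)
    obtain i j where k: "k = (i, j)"
      by (cases k)
    let ?m = "Poly_Mapping.single k (lk p k)" and ?s = "\<Sum>k \<in> A. Poly_Mapping.single k (lk p k)"
    have "L (lmonom (- i) (- j)) = cnj (L (lmonom i j))"
      using insert.prems pos_def by (simp add: k pos_def_functional_def D2_def abs_le_iff)
    moreover have "(- i, - j) \<in> D2"
      using insert.prems by (auto simp: k D2_def)
    ultimately have m: "L (ldag ?m) = cnj (L ?m)"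
      using insert.prems by (simp add: k L_lscale ldag_lscale flip: lscale_lmonom)
    have "ks ?m \<subseteq> D2"
      using insert.prems by simp
    moreover have "ks ?s \<subseteq> D2"
      using insert.prems by (intro keys_sum_subset) auto
    moreover from calculation have "ks (ldag ?m) \<subseteq> D2" "ks (ldag ?s) \<subseteq> D2"
      by (force simp: keys_ldag D2_def)+
    ultimately show ?case
      using m insert by (simp add: L_add ldag_add)
  qed simp
  from this[of "ks p"] assms show ?thesis
    by (simp flip: laurent_decomp)
qed

lemma ip_commute: "ks p \<subseteq> D \<Longrightarrow> ks q \<subseteq> D \<Longrightarrow> ip L q p = cnj (ip L p q)"
  using L_ldag[OF keys_ip, of p q] by (simp add: ip_def ldag_mult mult.commute)

lemma ip_add_right: "ks p \<subseteq> D \<Longrightarrow> ks q \<subseteq> D \<Longrightarrow> ks q' \<subseteq> D \<Longrightarrow> ip L p (q + q') = ip L p q + ip L p q'"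
  by (simp add: ip_commute[of _ p] ip_add_left keys_plus_subset)

lemma ip_lscale_right: "ks p \<subseteq> D \<Longrightarrow> ks q \<subseteq> D \<Longrightarrow> ip L p (lscale c q) = cnj c * ip L p q"
  by (simp add: ip_commute[of _ p] ip_lscale_left keys_lscale_subset)

lemma ip_diff_left:
  assumes "ks p \<subseteq> D" "ks p' \<subseteq> D" "ks q \<subseteq> D"
  shows "ip L (p - p') q = ip L p q - ip L p' q"
  using ip_add_left[of "p - p'" p' q] assms by (simp add: keys_minus_subset)

lemma ip_sum_left:
  assumes "\<And>a. a \<in> A \<Longrightarrow> ks (f a) \<subseteq> D" "ks q \<subseteq> D"
  shows "ip L (\<Sum>a \<in> A. f a) q = (\<Sum>a \<in> A. ip L (f a) q)"
  using assms(1)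
  by (induction A rule: infinite_finite_induct) (simp_all add: assms(2) ip_add_left keys_sum_subset)

lemma ip_sum_right:
  assumes "\<And>a. a \<in> A \<Longrightarrow> ks (f a) \<subseteq> D" "ks q \<subseteq> D"
  shows "ip L q (\<Sum>a \<in> A. f a) = (\<Sum>a \<in> A. ip L q (f a))"
  using assms by (simp add: ip_commute[of _ q] ip_sum_left keys_sum_subset)

lemma ip_pos: "ks p \<subseteq> D \<Longrightarrow> p \<noteq> 0 \<Longrightarrow> 0 < ip L p p"
  using pos_def by (simp add: pos_def_functional_def Pi_hat_iff ip_def)

text \<open>Conjugate linearity in the second argument extends orthogonality from the monomials of
  \<open>T\<close> to all polynomials supported in \<open>T\<close>.\<close>

lemma perp_ip:
  assumes "perp L p T" "ks q \<subseteq> T" "ks p \<subseteq> D" "T \<subseteq> D"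
  shows "ip L p q = 0"
proof -
  have "ip L p (Poly_Mapping.single k (lk q k)) = 0" if "k \<in> ks q" for k
  proof -
    obtain i j where k: "k = (i, j)"
      by (cases k)
    have "ip L p (lmonom i j) = 0" and "(i, j) \<in> D"
      using assms that by (auto simp: perp_def k)
    then show ?thesis
      using assms(3) by (simp add: k ip_lscale_right flip: lscale_lmonom)
  qed
  then have "ip L p (\<Sum>k \<in> ks q. Poly_Mapping.single k (lk q k)) = 0"
    using assms by (subst ip_sum_right) auto
  then show ?thesis
    by (simp flip: laurent_decomp)
qed

lemma perp_ip':
  assumes "perp L p T" "ks q \<subseteq> T" "ks p \<subseteq> D" "T \<subseteq> D"
  shows "ip L q p = 0"
  using perp_ip[OF assms] ip_commute[of p q] assms by auto

lemma perp_lrev: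
  assumes "perp L p (box a b c d)" "ks p \<subseteq> D" "box a b c d \<subseteq> D"
  shows "perp L (lrev n m p) (box (n - b) (n - a) (m - d) (m - c))"
  unfolding perp_def
proof clarify
  fix i j assume ij: "(i, j) \<in> box (n - b) (n - a) (m - d) (m - c)"
  have "ip L (lrev n m p) (lmonom i j) = ip L (lmonom (n - i) (m - j)) p"
    using ip_lrev[of L n m p "lmonom (n - i) (m - j)"] by (simp add: lrev_lmonom)
  also have "\<dots> = 0"
    using ij by (intro perp_ip'[OF assms(1) _ assms(2,3)]) auto
  finally show "ip L (lrev n m p) (lmonom i j) = 0" .
qed

section \<open>Orthonormal polynomials\<close>

text \<open>Gram-Schmidt, one exponent at a time: the projection onto the old monomials is corrected
  by a multiple of the component \<open>d\<close> of the new monomial that is orthogonal to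
  them.\<close>

lemma projection_exists:
  assumes "finite T" "T \<subseteq> D" "ks x \<subseteq> D"
  shows "\<exists>y. ks y \<subseteq> T \<and> perp L (x - y) T"
  using assms
proof (induction T arbitrary: x)
  case empty
  show ?case
    by (rule exI[of _ 0]) (simp add: perp_def)
next
  case (insert a T)
  obtain i j where a: "a = (i, j)"
    by (cases a)
  have TD: "T \<subseteq> D" and aD: "(i, j) \<in> D" and aT: "(i, j) \<notin> T"
    using insert.prems insert.hyps by (auto simp: a)
  obtain y1 where y1: "ks y1 \<subseteq> T" "perp L (x - y1) T"
    using insert.IH[of x] insert.prems by auto
  obtain y2 where y2: "ks y2 \<subseteq> T" "perp L (lmonom i j - y2) T"
    using insert.IH[of "lmonom i j"] TD aD by auto
  define d where "d = lmonom i j - y2"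
  have dD: "ks d \<subseteq> D"
    unfolding d_def by (rule keys_minus_subset) (use y2 TD aD in auto)
  have "(i, j) \<notin> ks y2"
    using y2(1) aT by auto
  then have "lk d (i, j) = 1"
    by (simp add: d_def lookup_minus lookup_lmonom in_keys_iff)
  then have "d \<noteq> 0"
    by auto
  then have "0 < ip L d d"
    by (rule ip_pos[OF dD])
  moreover have "ip L d (d + y2) = ip L d d + ip L d y2"
    using y2(1) TD dD by (intro ip_add_right) auto
  moreover have "ip L d y2 = 0"
    using y2 TD dD by (intro perp_ip[of d T]) (auto simp: d_def)
  \<comment> \<open>The new monomial is \<open>d + y2\<close> and \<open>d\<close> is orthogonal to
    \<open>y2\<close>, so this inner product equals \<open>ip L d d\<close>, which is positive. It
    is the divisor in \<open>c\<close>.\<close>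
  ultimately have nz: "ip L d (lmonom i j) \<noteq> 0"
    by (auto simp: d_def)
  \<comment> \<open>Chosen so that \<open>x - y\<close> becomes orthogonal to the new monomial;
    orthogonality to \<open>T\<close> survives because \<open>d\<close> has it too.\<close>
  define c where "c = ip L (x - y1) (lmonom i j) / ip L d (lmonom i j)"
  define y where "y = y1 + lscale c d"
  have dT: "ks d \<subseteq> insert a T"
    unfolding d_def by (rule keys_minus_subset) (use y2 in \<open>auto simp: a\<close>)
  have "ks y \<subseteq> insert a T"
    unfolding y_def using y1 dT by (intro keys_plus_subset keys_lscale_subset) auto
  moreover have xD: "ks (x - y1) \<subseteq> D"
    by (rule keys_minus_subset) (use insert.prems y1 in auto)
  have eq: "ip L (x - y) q = ip L (x - y1) q - c * ip L d q" if "ks q \<subseteq> D" for q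
  proof -
    have "x - y = (x - y1) - lscale c d"
      by (simp add: y_def)
    then show ?thesis
      using that xD dD by (simp only: ip_diff_left ip_lscale_left keys_lscale_subset)
  qed
  have "ip L (x - y) (lmonom k l) = 0" if "(k, l) \<in> insert a T" for k l
  proof (cases "(k, l) = a")
    case True
    then show ?thesis
      using aD nz by (simp add: eq a c_def)
  next
    case False
    then have "(k, l) \<in> T"
      using that by auto
    then show ?thesis
      using perpD[OF y1(2)] perpD[OF y2(2)] TD by (auto simp: eq d_def)
  qed
  ultimately show ?case
    by (auto simp: perp_def)
qed

text \<open>Existence: normalize the component of the monomial \<open>k\<close> orthogonal to the
  other monomials of \<open>S\<close>. Uniqueness: a combination of two candidates without the
  monomial \<open>k\<close> is both supported in and orthogonal to \<open>S - {k}\<close>, hence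
  zero. This makes the definite descriptions in \<open>phi\<close> and \<open>phi_t\<close>
  meaningful.\<close>

lemma onp_ex1:
  assumes S: "S \<subseteq> D" and k: "k \<in> S"
  shows "\<exists>!p. is_onp L S k p"
proof -
  have fS: "finite S"
    using S by (rule finite_subset) (simp add: D_def)
  obtain a b where ab: "k = (a, b)"
    by (cases k)
  let ?T = "S - {k}"
  have TD: "?T \<subseteq> D"
    using S by auto
  obtain y where y: "ks y \<subseteq> ?T" "perp L (lmonom a b - y) ?T"
    using projection_exists[of ?T "lmonom a b"] S k fS by (auto simp: ab)
  define d where "d = lmonom a b - y"
  have dS: "ks d \<subseteq> S"
    unfolding d_def by (rule keys_minus_subset) (use y k in \<open>auto simp: ab\<close>)
  have "k \<notin> ks y"
    using y(1) by auto
  then have dk: "lk d k = 1"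
    by (simp add: d_def ab lookup_minus lookup_lmonom in_keys_iff)
  then have "d \<noteq> 0"
    by auto
  then have pos: "0 < ip L d d"
    using dS S by (intro ip_pos) auto
  define r where "r = 1 / sqrt (Re (ip L d d))"
  have "0 < Re (ip L d d)" and im: "Im (ip L d d) = 0"
    using pos by (auto simp: less_complex_def)
  then have r: "0 < r" and "r * r * Re (ip L d d) = 1"
    by (auto simp: r_def field_simps)
  then have r2: "complex_of_real r * (complex_of_real r * ip L d d) = 1"
    using im by (simp add: complex_eq_iff)
  have ex: "is_onp L S k (lscale r d)"
    unfolding is_onp_def
  proof (intro conjI)
    show "lscale r d \<in> lspan S"
      using dS by (simp add: lspan_iff keys_lscale_subset)
    show "0 < lk (lscale r d) k"
      using r by (simp add: dk less_complex_def)
    show "ip L (lscale r d) (lscale r d) = 1"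
      using r2 subset_trans[OF dS S]
      by (simp add: ip_lscale_left ip_lscale_right keys_lscale_subset)
    show "\<forall>(i, j) \<in> ?T. ip L (lscale r d) (lmonom i j) = 0"
    proof -
      have "ip L (lscale r d) (lmonom i j) = 0" if "(i, j) \<in> ?T" for i j
      proof -
        have "ip L d (lmonom i j) = 0" and "ks (lmonom i j) \<subseteq> D"
          using perpD[OF y(2) that] that S by (auto simp: d_def)
        then show ?thesis
          using dS S by (subst ip_lscale_left) auto
      qed
      then show ?thesis
        by auto
    qed
  qed
  have uniq: "p = q" if p: "is_onp L S k p" and q: "is_onp L S k q" for p q
  proof -
    have pS: "ks p \<subseteq> S" and qS: "ks q \<subseteq> S" and pT: "perp L p ?T" and qT: "perp L q ?T"
      and pk: "0 < lk p k" and qk: "0 < lk q k" and p1: "ip L p p = 1" and q1: "ip L q q = 1"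
      using p q by (auto simp: is_onp_def lspan_iff perp_def)
    \<comment> \<open>The factor that cancels the coefficient at \<open>k\<close> in
      \<open>p - lscale c q\<close>. It is positive, and equality of norms will force it to be
      1.\<close>
    define c where "c = lk p k / lk q k"
    have c: "0 < c"
      using pk qk by (auto simp: c_def less_complex_def complex_eq_iff Re_divide Im_divide)
    define e where "e = p - lscale c q"
    have eS: "ks e \<subseteq> S"
      unfolding e_def using pS qS by (intro keys_minus_subset keys_lscale_subset)
    have ek: "lk e k = 0"
      using qk by (simp add: e_def lookup_minus c_def)
    then have "ks e \<subseteq> ?T"
      using eS by (auto simp: in_keys_iff)
    moreover have "perp L e ?T"
    proof -
      have "ip L e (lmonom i j) = 0" if "(i, j) \<in> ?T" for i j
      proof -
        have "ks (lmonom i j) \<subseteq> D" "ks p \<subseteq> D" "ks q \<subseteq> D"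
          using that pS qS S by auto
        then show ?thesis
          using perpD[OF pT that] perpD[OF qT that]
          by (simp add: e_def ip_diff_left ip_lscale_left keys_lscale_subset)
      qed
      then show ?thesis
        by (auto simp: perp_def)
    qed
    ultimately have "ip L e e = 0"
      using eS S by (intro perp_ip[of e ?T e]) auto
    then have "e = 0"
      using ip_pos[of e] eS S by auto
    then have pc: "p = lscale c q"
      by (simp add: e_def)
    have "ip L p p = c * (cnj c * ip L q q)"
      unfolding pc using subset_trans[OF qS S]
      by (simp add: ip_lscale_left ip_lscale_right keys_lscale_subset)
    then have "c * cnj c = 1"
      using p1 q1 by simp
    moreover obtain t where t: "c = complex_of_real t" "0 < t"
      using c that[of "Re c"] by (auto simp: less_complex_def complex_eq_iff)
    ultimately have "t * t = 1"
      by (metis complex_cnj_complex_of_real of_real_eq_1_iff of_real_mult)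
    then have "t = 1"
      using t(2) by (simp add: power2_eq_1_iff flip: power2_eq_square)
    then show "p = q"
      by (simp add: pc t)
  qed
  show ?thesis
    using ex uniq by blast
qed

lemma independent_monomials: "\<not> laurent.dependent ((\<lambda>(i, j). lmonom i j) ` T)"
  unfolding laurent.dependent_def
proof clarify
  fix i j
  assume "lmonom i j \<in> laurent.span ((\<lambda>(i, j). lmonom i j) ` T - {lmonom i j})"
  moreover have "(\<lambda>(i, j). lmonom i j) ` T - {lmonom i j} \<subseteq> (\<lambda>(i, j). lmonom i j) ` (T - {(i, j)})"
    by auto
  ultimately have "lmonom i j \<in> lspan (T - {(i, j)})"
    unfolding lspan_def using laurent.span_mono by blast
  then show False
    by (simp add: lspan_iff)
qed

text \<open>Everything in the span of the earlier elements is orthogonal to the next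
  \<open>x\<close>, whereas \<open>ip L x x\<close> is positive, so \<open>x\<close> is outside that
  span. Disjointness is recorded because \<open>expansion\<close> adds the two
  cardinalities.\<close>

lemma independent_orthogonal:
  assumes "finite F" "S \<subseteq> D" "T \<subseteq> S"
    and "\<And>x. x \<in> F \<Longrightarrow> ks x \<subseteq> S" "\<And>x. x \<in> F \<Longrightarrow> perp L x T" "0 \<notin> F"
    and "\<And>x y. x \<in> F \<Longrightarrow> y \<in> F \<Longrightarrow> x \<noteq> y \<Longrightarrow> ip L x y = 0"
  shows "\<not> laurent.dependent (F \<union> (\<lambda>(i, j). lmonom i j) ` T)
    \<and> F \<inter> (\<lambda>(i, j). lmonom i j) ` T = {}"
  using assms(1,4-)
proof (induction F)
  case empty
  then show ?case
    by (simp add: independent_monomials)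
next
  case (insert x F)
  let ?B = "F \<union> (\<lambda>(i, j). lmonom i j) ` T"
  have xD: "ks x \<subseteq> D" and xT: "perp L x T"
    using insert.prems assms(2) by blast+
  have span: "ks y \<subseteq> D \<and> ip L y x = 0" if "y \<in> laurent.span ?B" for y
    using that
  proof (induction rule: laurent.span_induct_alt)
    case (step c b y)
    have "ks b \<subseteq> D \<and> ip L b x = 0"
    proof (cases "b \<in> F")
      case True
      then have "ks b \<subseteq> S" "b \<noteq> x"
        using insert.prems(1)[of b] insert.hyps by auto
      then show ?thesis
        using insert.prems(4)[of b x] True assms(2) by blast
    next
      case False
      then obtain i j where "b = lmonom i j" "(i, j) \<in> T"
        using step.hyps by auto
      then have "ks b \<subseteq> T"
        by simp
      moreover have "T \<subseteq> D"
        using assms(2,3) by blast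
      ultimately show ?thesis
        using perp_ip'[OF xT _ xD, of b] by blast
    qed
    then show ?case
      using step.IH xD by (simp add: keys_plus_subset keys_lscale_subset ip_add_left ip_lscale_left)
  qed simp
  have "x \<noteq> 0"
    using insert.prems(3) by auto
  then have "ip L x x \<noteq> 0"
    using ip_pos[OF xD] by auto
  with span[of x] have x: "x \<notin> laurent.span ?B"
    by auto
  moreover from x have "x \<notin> ?B"
    by (metis laurent.span_base)
  moreover have "\<not> laurent.dependent ?B \<and> F \<inter> (\<lambda>(i, j). lmonom i j) ` T = {}"
    by (rule insert.IH) (use insert.prems in blast)+
  ultimately show ?case
    using laurent.independent_insertI[of x ?B] by simp
qed

text \<open>
  By a dimension count, an orthonormal family of the right size spans the orthogonal complement
  of \<open>T\<close> in \<open>S\<close>.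
\<close>

lemma expansion:
  assumes "S \<subseteq> D" "T \<subseteq> S" "finite A" "card A + card T = card S"
    and eS: "\<And>a. a \<in> A \<Longrightarrow> ks (e a) \<subseteq> S" and eT: "\<And>a. a \<in> A \<Longrightarrow> perp L (e a) T"
    and ee: "\<And>a b. a \<in> A \<Longrightarrow> b \<in> A \<Longrightarrow> ip L (e a) (e b) = (if a = b then 1 else 0)"
    and p: "ks p \<subseteq> S" "perp L p T"
  shows "p = (\<Sum>a \<in> A. lscale (ip L p (e a)) (e a))"
proof (rule ccontr)
  let ?mon = "\<lambda>(i, j). lmonom i j"
  let ?s = "\<Sum>a \<in> A. lscale (ip L p (e a)) (e a)"
  \<comment> \<open>The remainder of the expansion, orthogonal to \<open>T\<close> and to every
    \<open>e a\<close>; if nonzero, it is one independent element too many.\<close>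
  define r where "r = p - ?s"
  assume "p \<noteq> ?s"
  then have r0: "r \<noteq> 0"
    by (simp add: r_def)
  have eD: "ks (e a) \<subseteq> D" if "a \<in> A" for a
    using eS[OF that] assms(1) by blast
  have pD: "ks p \<subseteq> D"
    using p assms(1) by blast
  have sS: "ks ?s \<subseteq> S"
    using eS by (intro keys_sum_subset keys_lscale_subset)
  then have sD: "ks ?s \<subseteq> D"
    using assms(1) by blast
  have rS: "ks r \<subseteq> S"
    unfolding r_def using p(1) sS by (rule keys_minus_subset)
  have fS: "finite S"
    using assms(1) by (rule finite_subset) (simp add: D_def)
  have ip_r: "ip L r q = ip L p q - (\<Sum>a \<in> A. ip L p (e a) * ip L (e a) q)" if "ks q \<subseteq> D" for q
    using that eD pD sD
    by (simp add: r_def ip_diff_left ip_sum_left ip_lscale_left keys_lscale_subset)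
  have rT: "perp L r T"
    unfolding perp_def
  proof clarify
    fix i j assume ij: "(i, j) \<in> T"
    then have "ks (lmonom i j) \<subseteq> D"
      using assms(1,2) by auto
    then show "ip L r (lmonom i j) = 0"
      using perpD[OF eT ij] perpD[OF p(2) ij] by (simp add: ip_r)
  qed
  have re: "ip L r (e a) = 0" if "a \<in> A" for a
  proof -
    have "(\<Sum>b \<in> A. ip L p (e b) * ip L (e b) (e a)) = (\<Sum>b \<in> A. if a = b then ip L p (e b) else 0)"
      using ee that by (intro sum.cong) auto
    then show ?thesis
      using that eD assms(3) by (simp add: ip_r)
  qed
  have e0: "e a \<noteq> 0" if "a \<in> A" for a
    using ee[OF that that] by auto
  have inj: "inj_on e A"
  proof (rule inj_onI)
    fix a b assume "a \<in> A" "b \<in> A" "e a = e b"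
    then show "a = b"
      using ee[of a b] ee[of a a] by (simp split: if_splits)
  qed
  have rE: "r \<notin> e ` A"
  proof
    assume "r \<in> e ` A"
    then obtain a where a: "a \<in> A" "r = e a"
      by auto
    then show False
      using re[OF a(1)] ee[OF a(1) a(1)] by simp
  qed
  let ?F = "insert r (e ` A)"
  have er: "ip L (e a) r = 0" if "a \<in> A" for a
    using re[OF that] ip_commute[of r "e a"] rS eD[OF that] assms(1) by auto
  \<comment> \<open>These are \<open>card A + 1 + card T = card S + 1\<close> elements of a span
    with \<open>card S\<close> generators; the injectivity of \<open>e\<close> and \<open>rE\<close>
    ensure that none is counted twice.\<close>
  have *: "\<not> laurent.dependent (?F \<union> ?mon ` T) \<and> ?F \<inter> ?mon ` T = {}"
  proof (rule independent_orthogonal[OF _ assms(1,2)])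
    fix x y assume "x \<in> ?F" "y \<in> ?F" "x \<noteq> y"
    then show "ip L x y = 0"
      using re er ee by (elim insertE imageE) auto
  next
    show "finite ?F"
      using assms(3) by simp
    show "0 \<notin> ?F"
      using r0 e0 by auto
  next
    fix x assume "x \<in> ?F"
    then show "ks x \<subseteq> S" "perp L x T"
      using rS rT eS eT by (elim insertE imageE; simp)+
  qed
  have "?F \<union> ?mon ` T \<subseteq> lspan S"
    using rS eS assms(2) by (auto simp: lspan_iff)
  with * have "card (?F \<union> ?mon ` T) \<le> card (?mon ` S)"
    using laurent.independent_span_bound[of "?mon ` S" "?F \<union> ?mon ` T"] fS by (simp add: lspan_def)
  also have "\<dots> \<le> card S"
    using fS by (rule card_image_le)
  finally have "card (?F \<union> ?mon ` T) \<le> card S" .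
  moreover have "card (?mon ` T) = card T"
    by (rule card_image) (auto simp: inj_on_def)
  moreover have "card ?F = Suc (card A)"
    using rE assms(3) inj by (simp add: card_image)
  moreover have "finite T"
    using assms(2) fS by (rule finite_subset)
  ultimately have "Suc (card A) + card T \<le> card S"
    using * assms(3) card_Un_disjoint[of ?F "?mon ` T"] by simp
  then show False
    using assms(4) by simp
qed

end

section \<open>Column vectors of Laurent polynomials\<close>

lemma dim_mip [simp]: "dim_row (mip L X Y) = dim_row X" "dim_col (mip L X Y) = dim_row Y"
  by (simp_all add: mip_def mdag_def)

lemma mip_index:
  assumes "dim_col X = 1" "dim_col Y = 1" "i < dim_row X" "j < dim_row Y"
  shows "mip L X Y $$ (i, j) = ip L (X $$ (i, 0)) (Y $$ (j, 0))"
  using assms by (simp add: mip_def mdag_def ip_def scalar_prod_def)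

lemma cmat_mult_index:
  assumes "dim_col Y = 1" "dim_col C = dim_row Y" "i < dim_row C"
  shows "(cmat C * Y) $$ (i, 0) = (\<Sum>k < dim_row Y. lscale (C $$ (i, k)) (Y $$ (k, 0)))"
  using assms by (simp add: scalar_prod_def lscale_def atLeast0LessThan)

lemma mat_adjoint_dim [simp]: "dim_row (mat_adjoint A) = dim_col A" "dim_col (mat_adjoint A) = dim_row A"
  by (simp_all add: mat_adjoint_def)

lemma mat_adjoint_index:
  fixes A :: "complex mat"
  shows "i < dim_col A \<Longrightarrow> j < dim_row A \<Longrightarrow> mat_adjoint A $$ (i, j) = cnj (A $$ (j, i))"
  by (simp add: mat_adjoint_def mat_of_rows_index)

text \<open>The transposed reversal as an operation on arbitrary columns, so that the same lemmas
  serve \<open>Phi\<close> and \<open>Phi_t\<close>. The two transposes cancel, and it acts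
  entrywise as \<open>lrev\<close>.\<close>

definition colrev :: "int \<Rightarrow> int \<Rightarrow> laurent mat \<Rightarrow> laurent mat" where
  "colrev n m X = (lmonom n m \<cdot>\<^sub>m mdag X)\<^sup>T"

lemma colrev_dim [simp]: "dim_row (colrev n m X) = dim_row X" "dim_col (colrev n m X) = dim_col X"
  by (simp_all add: colrev_def mdag_def)

lemma colrev_index: "i < dim_row X \<Longrightarrow> j < dim_col X \<Longrightarrow> colrev n m X $$ (i, j) = lrev n m (X $$ (i, j))"
  by (simp add: colrev_def mdag_def lrev_def)

lemma mip_smult:
  assumes "dim_col X = 1" "dim_col Y = 1"
  shows "mip L (lmonom a b \<cdot>\<^sub>m X) (lmonom a b \<cdot>\<^sub>m Y) = mip L X Y"
  by (rule eq_matI) (simp_all add: mip_index assms ip_shift)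

lemma mip_colrev:
  assumes "dim_col X = 1" "dim_col Y = 1"
  shows "mip L (colrev n m X) (colrev n m Y) = (mip L Y X)\<^sup>T"
  by (rule eq_matI) (simp_all add: mip_index assms colrev_index ip_lrev)

lemma mat_add_eq_imp_diff:
  fixes P Q :: "'a :: ab_group_add mat"
  assumes "X = P + Q" "P \<in> carrier_mat a b" "Q \<in> carrier_mat a b"
  shows "P = X - Q"
  unfolding assms(1) using assms(2,3) by (intro eq_matI) auto

context pos_def_form
begin

text \<open>\<open>S\<close> bounds the supports of the entries and \<open>T\<close> is what they
  annihilate; in general neither contains the other. Keeping both inside \<open>D\<close> provides
  the side conditions for sesquilinearity.\<close>

definition colvec :: "(int \<times> int) set \<Rightarrow> (int \<times> int) set \<Rightarrow> laurent mat \<Rightarrow> bool" where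
  "colvec S T X \<longleftrightarrow> dim_col X = 1 \<and> S \<subseteq> D \<and> T \<subseteq> D \<and>
     (\<forall>i < dim_row X. ks (X $$ (i, 0)) \<subseteq> S \<and> perp L (X $$ (i, 0)) T)"

lemma colvecD:
  assumes "colvec S T X"
  shows "dim_col X = 1" "S \<subseteq> D" "T \<subseteq> D"
    and "i < dim_row X \<Longrightarrow> ks (X $$ (i, 0)) \<subseteq> S"
    and "i < dim_row X \<Longrightarrow> ks (X $$ (i, 0)) \<subseteq> D"
    and "i < dim_row X \<Longrightarrow> perp L (X $$ (i, 0)) T"
  using assms unfolding colvec_def by blast+

lemma colvec_mono: "colvec S T X \<Longrightarrow> S \<subseteq> S' \<Longrightarrow> S' \<subseteq> D \<Longrightarrow> T' \<subseteq> T \<Longrightarrow> colvec S' T' X"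
  unfolding colvec_def by (metis perp_subset subset_trans)

lemma mip_adjoint:
  assumes "colvec S T X" "colvec S' T' Y"
  shows "mip L Y X = mat_adjoint (mip L X Y)"
proof (rule eq_matI; simp)
  fix i j assume ij: "i < dim_row Y" "j < dim_row X"
  then have "ks (Y $$ (i, 0)) \<subseteq> D" "ks (X $$ (j, 0)) \<subseteq> D"
    using assms by (simp_all add: colvecD)
  then show "mip L Y X $$ (i, j) = mat_adjoint (mip L X Y) $$ (i, j)"
    using ij colvecD(1)[OF assms(1)] colvecD(1)[OF assms(2)]
    by (simp add: mip_index mat_adjoint_index ip_commute[of "X $$ (j, 0)"])
qed

text \<open>The source of all vanishing blocks below: orthogonality is read off from an inclusion of
  boxes.\<close>

lemma mip_perp:
  assumes "colvec S T X" "colvec S' T' Y" "S' \<subseteq> T"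
  shows "mip L X Y = 0\<^sub>m (dim_row X) (dim_row Y)" and "mip L Y X = 0\<^sub>m (dim_row Y) (dim_row X)"
proof -
  have "ip L (X $$ (i, 0)) (Y $$ (j, 0)) = 0" and "ip L (Y $$ (j, 0)) (X $$ (i, 0)) = 0"
    if "i < dim_row X" "j < dim_row Y" for i j
  proof -
    have *: "perp L (X $$ (i, 0)) T" "ks (Y $$ (j, 0)) \<subseteq> T" "ks (X $$ (i, 0)) \<subseteq> D" "T \<subseteq> D"
      using colvecD(3,5,6)[OF assms(1)] colvecD(4)[OF assms(2)] assms(3) that by blast+
    show "ip L (X $$ (i, 0)) (Y $$ (j, 0)) = 0" and "ip L (Y $$ (j, 0)) (X $$ (i, 0)) = 0"
      using perp_ip[OF *] perp_ip'[OF *] by auto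
  qed
  then show "mip L X Y = 0\<^sub>m (dim_row X) (dim_row Y)" and "mip L Y X = 0\<^sub>m (dim_row Y) (dim_row X)"
    using colvecD(1)[OF assms(1)] colvecD(1)[OF assms(2)] by (auto intro!: eq_matI simp: mip_index)
qed

text \<open>Matrix form of \<open>expansion\<close>: by the count of rows the two columns together
  are an orthonormal basis of the complement of \<open>T\<close> in \<open>S\<close>. The second
  conclusion is Parseval's identity.\<close>

lemma mat_expansion:
  assumes "T \<subseteq> S" "dim_row Y1 + dim_row Y2 + card T = card S"
    and X: "colvec S T X" and Y1: "colvec S T Y1" and Y2: "colvec S T Y2"
    and on1: "mip L Y1 Y1 = 1\<^sub>m (dim_row Y1)" and on2: "mip L Y2 Y2 = 1\<^sub>m (dim_row Y2)"
    and on12: "mip L Y1 Y2 = 0\<^sub>m (dim_row Y1) (dim_row Y2)"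
  shows "X = cmat (mip L X Y1) * Y1 + cmat (mip L X Y2) * Y2"
    and "colvec S T X' \<Longrightarrow>
      mip L X X' = mip L X Y1 * mat_adjoint (mip L X' Y1) + mip L X Y2 * mat_adjoint (mip L X' Y2)"
proof -
  \<comment> \<open>A disjoint sum of the row indices merges the two columns into one family; sums
    over it split again by \<open>sum.Plus\<close>.\<close>
  define A where "A = {..<dim_row Y1} <+> {..<dim_row Y2}"
  define e where "e = (\<lambda>a. case a of Inl i \<Rightarrow> Y1 $$ (i, 0) | Inr i \<Rightarrow> Y2 $$ (i, 0))"
  have c: "dim_col X = 1" "dim_col Y1 = 1" "dim_col Y2 = 1" and SD: "S \<subseteq> D"
    using colvecD(1,2)[OF X] colvecD(1)[OF Y1] colvecD(1)[OF Y2] by auto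
  have Y21: "mip L Y2 Y1 = 0\<^sub>m (dim_row Y2) (dim_row Y1)"
    unfolding mip_adjoint[OF Y1 Y2] on12 by (rule eq_matI) (auto simp: mat_adjoint_index)
  have o11: "ip L (Y1 $$ (i, 0)) (Y1 $$ (j, 0)) = (if i = j then 1 else 0)"
    if "i < dim_row Y1" "j < dim_row Y1" for i j
    using mip_index[of Y1 Y1 i j L] c that by (simp add: on1)
  have o22: "ip L (Y2 $$ (i, 0)) (Y2 $$ (j, 0)) = (if i = j then 1 else 0)"
    if "i < dim_row Y2" "j < dim_row Y2" for i j
    using mip_index[of Y2 Y2 i j L] c that by (simp add: on2)
  have o12: "ip L (Y1 $$ (i, 0)) (Y2 $$ (j, 0)) = 0" if "i < dim_row Y1" "j < dim_row Y2" for i j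
    using mip_index[of Y1 Y2 i j L] c that by (simp add: on12)
  have o21: "ip L (Y2 $$ (i, 0)) (Y1 $$ (j, 0)) = 0" if "i < dim_row Y2" "j < dim_row Y1" for i j
    using mip_index[of Y2 Y1 i j L] c that by (simp add: Y21)
  have ee: "ip L (e a) (e b) = (if a = b then 1 else 0)" if "a \<in> A" "b \<in> A" for a b
    using that o11 o22 o12 o21 by (auto simp: A_def e_def split: if_splits)
  have expand: "p = (\<Sum>a \<in> A. lscale (ip L p (e a)) (e a))" if "ks p \<subseteq> S" "perp L p T" for p
  proof (rule expansion[of S T A e])
    show "ks (e a) \<subseteq> S" and "perp L (e a) T" if "a \<in> A" for a
      using that colvecD(4,6)[OF Y1] colvecD(4,6)[OF Y2] by (auto simp: A_def e_def del: subsetI)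
  qed (use assms(1,2) SD that ee in \<open>simp_all add: A_def card_Plus\<close>)
  have eD: "ks (e a) \<subseteq> D" if "a \<in> A" for a
  proof -
    have "ks (e a) \<subseteq> S"
      using that colvecD(4)[OF Y1] colvecD(4)[OF Y2] by (auto simp: A_def e_def del: subsetI)
    then show ?thesis
      using SD by blast
  qed
  show "X = cmat (mip L X Y1) * Y1 + cmat (mip L X Y2) * Y2"
  proof (rule eq_matI; simp add: c)
    fix i assume i: "i < dim_row X"
    then have "X $$ (i, 0) = (\<Sum>a \<in> A. lscale (ip L (X $$ (i, 0)) (e a)) (e a))"
      using colvecD(4,6)[OF X] by (intro expand)
    also have "\<dots> = (cmat (mip L X Y1) * Y1) $$ (i, 0) + (cmat (mip L X Y2) * Y2) $$ (i, 0)"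
      using i c by (simp add: A_def e_def sum.Plus cmat_mult_index mip_index del: index_mult_mat)
    finally show "X $$ (i, 0) = row (cmat (mip L X Y1)) i \<bullet> col Y1 0 + row (cmat (mip L X Y2)) i \<bullet> col Y2 0"
      using i c by simp
  qed
  assume X': "colvec S T X'"
  have c': "dim_col X' = 1"
    using X' by (rule colvecD)
  show "mip L X X' = mip L X Y1 * mat_adjoint (mip L X' Y1) + mip L X Y2 * mat_adjoint (mip L X' Y2)"
  proof (rule eq_matI; simp)
    fix i j assume i: "i < dim_row X" and j: "j < dim_row X'"
    let ?x = "X $$ (i, 0)" and ?y = "X' $$ (j, 0)"
    have x: "ks ?x \<subseteq> S" "perp L ?x T" "ks ?x \<subseteq> D" and y: "ks ?y \<subseteq> D"
      using colvecD(4-6)[OF X i] colvecD(5)[OF X' j] by blast+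
    have "ip L ?x ?y = ip L (\<Sum>a \<in> A. lscale (ip L ?x (e a)) (e a)) ?y"
      using expand[OF x(1,2)] by simp
    also have "\<dots> = (\<Sum>a \<in> A. ip L ?x (e a) * ip L (e a) ?y)"
      using eD y by (simp add: ip_sum_left ip_lscale_left keys_lscale_subset)
    also have "\<dots> = (\<Sum>a \<in> A. ip L ?x (e a) * cnj (ip L ?y (e a)))"
      by (intro sum.cong refl arg_cong2[where f = "(*)"] ip_commute y eD)
    finally show "mip L X X' $$ (i, j) = row (mip L X Y1) i \<bullet> col (mat_adjoint (mip L X' Y1)) j
        + row (mip L X Y2) i \<bullet> col (mat_adjoint (mip L X' Y2)) j"
      using i j c c'
      by (simp add: A_def e_def sum.Plus mip_index scalar_prod_def mat_adjoint_index atLeast0LessThan)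
  qed
qed

lemma colvec_shift:
  assumes "colvec (box a b c d) (box a' b' c' d') X"
    and "box (a + i) (b + i) (c + j) (d + j) \<subseteq> D" "box (a' + i) (b' + i) (c' + j) (d' + j) \<subseteq> D"
  shows "colvec (box (a + i) (b + i) (c + j) (d + j)) (box (a' + i) (b' + i) (c' + j) (d' + j))
    (lmonom i j \<cdot>\<^sub>m X)"
  using assms by (auto simp: colvec_def keys_shift_box perp_shift simp del: mem_box)

lemma colvec_colrev:
  assumes "colvec (box a b c d) (box a' b' c' d') X"
    and "box (n - b) (n - a) (m - d) (m - c) \<subseteq> D" "box (n - b') (n - a') (m - d') (m - c') \<subseteq> D"
  shows "colvec (box (n - b) (n - a) (m - d) (m - c)) (box (n - b') (n - a') (m - d') (m - c'))
    (colrev n m X)"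
proof -
  have "perp L (lrev n m (X $$ (i, 0))) (box (n - b') (n - a') (m - d') (m - c'))"
    if "i < dim_row X" for i
    using perp_lrev[OF colvecD(6)[OF assms(1) that] colvecD(5)[OF assms(1) that] colvecD(3)[OF assms(1)]] .
  moreover have "ks (lrev n m (X $$ (i, 0))) \<subseteq> box (n - b) (n - a) (m - d) (m - c)"
    if "i < dim_row X" for i
    using keys_lrev_box[OF colvecD(4)[OF assms(1) that]] .
  ultimately show ?thesis
    using assms(2,3) colvecD(1)[OF assms(1)] by (simp add: colvec_def colrev_index)
qed

end

section \<open>The vector orthonormal polynomials\<close>

lemma dim_Phi [simp]: "dim_row (Phi L n m) = nat (m + 1)" "dim_col (Phi L n m) = 1"
  "dim_row (Phi_t L n m) = nat (n + 1)" "dim_col (Phi_t L n m) = 1"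
  by (simp_all add: Phi_def Phi_t_def)

lemma Phi_rev_transpose: "(Phi_rev L n m)\<^sup>T = colrev n m (Phi L n m)"
  "(Phi_t_rev L n m)\<^sup>T = colrev n m (Phi_t L n m)"
  by (simp_all add: Phi_rev_def Phi_t_rev_def colrev_def)

text \<open>The exponents in the strip 0..m up to and including (n, l) in the lexicographical
  order.\<close>

definition lexset :: "int \<Rightarrow> int \<Rightarrow> int \<Rightarrow> (int \<times> int) set" where
  "lexset n m l = box 0 (n - 1) 0 m \<union> box n n 0 l"

lemma phi_def': "phi L n m l = (THE p. is_onp L (lexset n m l) (n, l) p)"
proof -
  have "{(i, j). 0 \<le> i \<and> i < n \<and> 0 \<le> j \<and> j \<le> m} \<union> {(i, j). i = n \<and> 0 \<le> j \<and> j \<le> l} = lexset n m l"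
    by (auto simp: lexset_def)
  then show ?thesis
    by (simp add: phi_def)
qed

context pos_def_form
begin

lemma phi_facts:
  assumes "0 \<le> n" "n \<le> int N" "0 \<le> l" "l \<le> m" "m \<le> int M"
  shows "ks (phi L n m l) \<subseteq> lexset n m l" "0 < lk (phi L n m l) (n, l)"
    "ip L (phi L n m l) (phi L n m l) = 1" "perp L (phi L n m l) (lexset n m l - {(n, l)})"
proof -
  have "lexset n m l \<subseteq> D" "(n, l) \<in> lexset n m l"
    using assms by (auto simp: lexset_def D_def)
  then have "is_onp L (lexset n m l) (n, l) (phi L n m l)"
    unfolding phi_def' by (rule theI'[OF onp_ex1])
  then show "ks (phi L n m l) \<subseteq> lexset n m l" "0 < lk (phi L n m l) (n, l)"
    "ip L (phi L n m l) (phi L n m l) = 1" "perp L (phi L n m l) (lexset n m l - {(n, l)})"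
    by (simp_all add: is_onp_def lspan_iff perp_def)
qed

text \<open>Since k < l, the exponent (n, l) is missing from \<open>lexset n m k\<close>, so
  \<open>q\<close> uses only monomials that \<open>phi L n m l\<close> annihilates.\<close>

lemma phi_orthogonal:
  assumes "0 \<le> n" "n \<le> int N" "0 \<le> k" "k < l" "l \<le> m" "m \<le> int M"
    and "ks q \<subseteq> lexset n m k"
  shows "ip L (phi L n m l) q = 0" "ip L q (phi L n m l) = 0"
proof -
  have D: "ks (phi L n m l) \<subseteq> D" "lexset n m l - {(n, l)} \<subseteq> D"
    and q: "ks q \<subseteq> lexset n m l - {(n, l)}"
    using assms phi_facts(1)[of n l m] by (force simp: lexset_def D_def)+
  have "perp L (phi L n m l) (lexset n m l - {(n, l)})"
    using assms by (intro phi_facts) auto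
  then show "ip L (phi L n m l) q = 0" "ip L q (phi L n m l) = 0"
    using perp_ip[OF _ q D] perp_ip'[OF _ q D] by auto
qed

text \<open>For m = -1 both the column and the boxes are empty, so the convention for the empty
  vector is included.\<close>

lemma Phi_colvec:
  assumes "0 \<le> n" "n \<le> int N" "m \<le> int M"
  shows "colvec (box 0 n 0 m) (box 0 (n - 1) 0 m) (Phi L n m)"
  unfolding colvec_def
proof (intro conjI allI impI)
  fix i assume "i < dim_row (Phi L n m)"
  then have i: "i < nat (m + 1)" and l: "0 \<le> m - int i" "m - int i \<le> m"
    by auto
  show "ks (Phi L n m $$ (i, 0)) \<subseteq> box 0 n 0 m"
    using phi_facts(1)[OF assms(1,2) l assms(3)] assms(1) i
    by (auto simp: Phi_def lexset_def)
  have "perp L (phi L n m (m - int i)) (lexset n m (m - int i) - {(n, m - int i)})"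
    using phi_facts(4)[OF assms(1,2) l assms(3)] .
  then have "perp L (phi L n m (m - int i)) (box 0 (n - 1) 0 m)"
    by (rule perp_subset) (auto simp: lexset_def)
  then show "perp L (Phi L n m $$ (i, 0)) (box 0 (n - 1) 0 m)"
    using i by (simp add: Phi_def)
qed (use assms in \<open>auto simp: D_def\<close>)

lemma Phi_orthonormal:
  assumes "0 \<le> n" "n \<le> int N" "m \<le> int M"
  shows "mip L (Phi L n m) (Phi L n m) = 1\<^sub>m (nat (m + 1))"
proof (rule eq_matI)
  fix i j
  assume "i < dim_row (1\<^sub>m (nat (m + 1)))" "j < dim_col (1\<^sub>m (nat (m + 1)))"
  then have ij: "i < nat (m + 1)" "j < nat (m + 1)"
    by simp_all
  have "ip L (phi L n m (m - int i)) (phi L n m (m - int j)) = (if i = j then 1 else 0)"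
  proof (cases i j rule: linorder_cases)
    \<comment> \<open>Row \<open>i\<close> has leading exponent \<open>m - int i\<close>: the upper
      row is the larger one in the ordering and annihilates the lower one.\<close>
    case less
    then show ?thesis
      using assms ij phi_facts(1)[of n "m - int j" m]
      by (intro trans[OF phi_orthogonal(1)[of n "m - int j"]]) auto
  next
    case equal
    then show ?thesis
      using assms ij by (auto intro!: phi_facts)
  next
    case greater
    then show ?thesis
      using assms ij phi_facts(1)[of n "m - int i" m]
      by (intro trans[OF phi_orthogonal(2)[of n "m - int i"]]) auto
  qed
  then show "mip L (Phi L n m) (Phi L n m) $$ (i, j) = 1\<^sub>m (nat (m + 1)) $$ (i, j)"
    using ij by (auto simp: mip_index Phi_def)
qed simp_all

end

section \<open>Interchanging the variables\<close>

definition lswap :: "laurent \<Rightarrow> laurent" where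
  "lswap p = Poly_Mapping.map_key prod.swap p"

lemma lookup_lswap [simp]: "lk (lswap p) k = lk p (prod.swap k)"
  by (simp add: lswap_def map_key.rep_eq)

lemma lswap_lswap [simp]: "lswap (lswap p) = p"
  by (rule poly_mapping_eqI) simp

lemma lswap_0 [simp]: "lswap 0 = 0"
  by (rule poly_mapping_eqI) simp

lemma lswap_eq_0_iff [simp]: "lswap p = 0 \<longleftrightarrow> p = 0"
  by (metis lswap_0 lswap_lswap)

lemma lswap_add: "lswap (p + q) = lswap p + lswap q"
  by (rule poly_mapping_eqI) (simp add: lookup_add)

lemma lswap_minus: "lswap (p - q) = lswap p - lswap q"
  by (rule poly_mapping_eqI) (simp add: lookup_minus)

lemma lswap_single: "lswap (Poly_Mapping.single k c) = Poly_Mapping.single (prod.swap k) c"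
proof (rule poly_mapping_eqI)
  fix j show "lk (lswap (Poly_Mapping.single k c)) j = lk (Poly_Mapping.single (prod.swap k) c) j"
    by (cases j; cases k) (auto simp: lookup_single when_def)
qed

lemma lswap_lmonom [simp]: "lswap (lmonom i j) = lmonom j i"
  by (simp add: lmonom_def lswap_single)

lemma lswap_lconst [simp]: "lswap (lconst c) = lconst c"
  by (simp add: lconst_def lswap_single)

lemma lswap_mult: "lswap (p * q) = lswap p * lswap q"
proof (rule additive_mult)
  fix a b :: "int \<times> int" and c d
  have "prod.swap (a + b) = prod.swap a + prod.swap b"
    by (cases a; cases b) simp
  then show "lswap (Poly_Mapping.single a c * Poly_Mapping.single b d)
      = lswap (Poly_Mapping.single a c) * lswap (Poly_Mapping.single b d)"
    by (simp add: mult_single lswap_single)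
qed (simp_all add: lswap_add)

lemma lswap_lscale: "lswap (lscale c p) = lscale c (lswap p)"
  by (rule poly_mapping_eqI) simp

lemma lswap_ldag: "lswap (ldag p) = ldag (lswap p)"
proof (rule poly_mapping_eqI)
  fix k show "lk (lswap (ldag p)) k = lk (ldag (lswap p)) k"
    by (cases k) simp
qed

lemma keys_lswap: "ks (lswap p) = prod.swap ` ks p"
proof -
  have "k \<in> ks (lswap p) \<longleftrightarrow> prod.swap k \<in> ks p" for k
    by (simp add: in_keys_iff)
  then show ?thesis
    by (force simp: image_iff)
qed

lemma ip_lswap: "ip L (lswap p) (lswap q) = ip (L \<circ> lswap) p q"
  by (simp add: ip_def lswap_mult lswap_ldag)

lemma perp_lswap: "perp (L \<circ> lswap) p T \<Longrightarrow> perp L (lswap p) (prod.swap ` T)"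
  using ip_lswap[of L p "lmonom i j" for i j] by (auto simp: perp_def)

lemma swap_box [simp]: "prod.swap ` box a b c d = box c d a b"
  by (simp add: box_def product_swap)

lemma mip_lswap:
  assumes "dim_col X = 1" "dim_col Y = 1"
  shows "mip L (map_mat lswap X) (map_mat lswap Y) = mip (L \<circ> lswap) X Y"
  by (rule eq_matI) (simp_all add: mip_index assms ip_lswap)

lemma map_lswap_mult:
  assumes "dim_col A = dim_row B"
  shows "map_mat lswap (A * B) = map_mat lswap A * map_mat lswap B"
proof -
  have "lswap (\<Sum>k \<in> K. f k) = (\<Sum>k \<in> K. lswap (f k))" for f :: "nat \<Rightarrow> laurent" and K
    by (induction K rule: infinite_finite_induct) (simp_all add: lswap_add)
  then show ?thesis
    using assms by (intro eq_matI) (simp_all add: scalar_prod_def lswap_mult)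
qed

lemma map_lswap_simps:
  "dim_row A = dim_row B \<Longrightarrow> dim_col A = dim_col B \<Longrightarrow>
    map_mat lswap (A + B) = map_mat lswap A + map_mat lswap B"
  "dim_row A = dim_row B \<Longrightarrow> dim_col A = dim_col B \<Longrightarrow>
    map_mat lswap (A - B) = map_mat lswap A - map_mat lswap B"
  "map_mat lswap (lmonom i j \<cdot>\<^sub>m A) = lmonom j i \<cdot>\<^sub>m map_mat lswap A"
  "map_mat lswap (cmat C) = cmat C"
  "map_mat lswap (map_mat lswap A) = A"
  by (rule eq_matI; simp add: lswap_add lswap_minus lswap_mult)+

lemma colrev_lswap: "map_mat lswap (colrev n m X) = colrev m n (map_mat lswap X)"
  by (rule eq_matI) (simp_all add: colrev_index lrev_def lswap_mult lswap_ldag)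

lemma comp_lswap [simp]: "L \<circ> lswap \<circ> lswap = L"
  by (simp add: fun_eq_iff)

context pos_def_form
begin

text \<open>Every fact about \<open>Phi\<close> applied to \<open>L \<circ> lswap\<close>, with the
  bounds exchanged, becomes a fact about \<open>Phi_t\<close> for \<open>L\<close>.\<close>

lemma lswap_form: "pos_def_form M N (L \<circ> lswap)"
proof
  have sp: "lswap p \<in> Pi_sp N M" if "p \<in> Pi_sp M N" for p
    using that by (auto simp: Pi_sp_def lspan_iff keys_lswap)
  have hat: "lswap p \<in> Pi_hat N M" if "p \<in> Pi_hat M N" for p
    using that by (auto simp: Pi_hat_def lspan_iff keys_lswap)
  show "pos_def_functional M N (L \<circ> lswap)"
    using pos_def sp hat
    by (auto simp: pos_def_functional_def linear_functional_on_def lswap_add lswap_lscale lswap_mult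
        lswap_ldag)
qed

text \<open>The exponent set of the reverse lexicographical ordering is the mirror image of
  \<open>lexset m n l\<close>; uniqueness identifies the two polynomials.\<close>

lemma phi_t_eq:
  assumes "0 \<le> m" "m \<le> int M" "0 \<le> l" "l \<le> n" "n \<le> int N"
  shows "phi_t L n m l = lswap (phi (L \<circ> lswap) m n l)"
proof -
  interpret S: pos_def_form M N "L \<circ> lswap"
    by (rule lswap_form)
  let ?S = "prod.swap ` lexset m n l"
  note facts = S.phi_facts[OF assms]
  have "is_onp L ?S (l, m) (lswap (phi (L \<circ> lswap) m n l))"
    unfolding is_onp_def
  proof (intro conjI)
    have "prod.swap ` (lexset m n l - {(m, l)}) = ?S - {(l, m)}"
      by force
    then show "\<forall>(i, j) \<in> ?S - {(l, m)}. ip L (lswap (phi (L \<circ> lswap) m n l)) (lmonom i j) = 0"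
      using perp_lswap[OF facts(4)] by (simp add: perp_def)
  qed (use facts in \<open>auto simp: lspan_iff keys_lswap ip_lswap\<close>)
  moreover have "\<exists>!p. is_onp L ?S (l, m) p"
    using assms by (intro onp_ex1) (auto simp: lexset_def image_Un D_def image_iff)
  moreover have "{(i, j). 0 \<le> i \<and> i \<le> n \<and> 0 \<le> j \<and> j < m} \<union> {(i, j). 0 \<le> i \<and> i \<le> l \<and> j = m} = ?S"
    by (auto simp: lexset_def image_Un)
  ultimately show ?thesis
    by (simp add: phi_t_def the1_equality)
qed

lemma Phi_t_eq:
  assumes "0 \<le> m" "m \<le> int M" "n \<le> int N"
  shows "Phi_t L n m = map_mat lswap (Phi (L \<circ> lswap) m n)"
  by (rule eq_matI) (simp_all add: Phi_t_def Phi_def phi_t_eq assms)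

lemma colvec_lswap:
  assumes "pos_def_form.colvec M N (L \<circ> lswap) S T X"
  shows "colvec (prod.swap ` S) (prod.swap ` T) (map_mat lswap X)"
proof -
  interpret S: pos_def_form M N "L \<circ> lswap"
    by (rule lswap_form)
  have "S \<subseteq> S.D" "T \<subseteq> S.D" "dim_col X = 1"
    using S.colvecD(1-3)[OF assms] by auto
  moreover from this have "prod.swap ` S \<subseteq> D" "prod.swap ` T \<subseteq> D"
    by (auto simp: D_def S.D_def)
  moreover have "ks (lswap (X $$ (i, 0))) \<subseteq> prod.swap ` S"
    and "perp L (lswap (X $$ (i, 0))) (prod.swap ` T)" if "i < dim_row X" for i
    using S.colvecD(4,6)[OF assms that] by (auto simp only: keys_lswap intro!: image_mono perp_lswap)
  ultimately show ?thesis
    by (simp add: colvec_def)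
qed

lemma Phi_t_colvec:
  assumes "0 \<le> m" "m \<le> int M" "n \<le> int N"
  shows "colvec (box 0 n 0 m) (box 0 n 0 (m - 1)) (Phi_t L n m)"
  using colvec_lswap[OF pos_def_form.Phi_colvec[OF lswap_form assms]] by (simp add: Phi_t_eq assms)

lemma Phi_t_orthonormal:
  assumes "0 \<le> m" "m \<le> int M" "n \<le> int N"
  shows "mip L (Phi_t L n m) (Phi_t L n m) = 1\<^sub>m (nat (n + 1))"
  using pos_def_form.Phi_orthonormal[OF lswap_form assms] by (simp add: Phi_t_eq assms mip_lswap)

end

section \<open>The recurrence formulas\<close>

lemma mat_zero_eq_add:
  fixes P Q :: "'a :: ab_group_add mat"
  assumes "0\<^sub>m a b = P + Q" "P \<in> carrier_mat a b" "Q \<in> carrier_mat a b"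
  shows "Q = - P"
proof (rule eq_matI)
  fix i j assume "i < dim_row (- P)" "j < dim_col (- P)"
  then show "Q $$ (i, j) = (- P) $$ (i, j)"
    using arg_cong[OF assms(1), of "\<lambda>X. X $$ (i, j)"] assms(2,3) by (simp add: minus_unique)
qed (use assms(2,3) in auto)

context pos_def_form
begin

section \<open>Expansions that mix the two orderings\<close>

context
  fixes n m :: int
  assumes n: "0 \<le> n" "n \<le> int N" and m: "0 \<le> m" "m \<le> int M"
begin

lemma box_D: "box 0 n 0 m \<subseteq> D" "box 0 (n - 1) 0 m \<subseteq> D" "box 0 n 0 (m - 1) \<subseteq> D"
    "box 1 n 0 m \<subseteq> D" "box 0 n 1 m \<subseteq> D" "box 1 (n - 1) 0 m \<subseteq> D" "box 0 (n - 1) 1 m \<subseteq> D"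
    "box 1 n 0 (m - 1) \<subseteq> D" "box 0 (n - 1) 0 (m - 1) \<subseteq> D"
  using n m by (auto simp: D_def)

text \<open>\<open>mat_expansion\<close> wants the same boxes for all its columns: supports are
  enlarged to \<open>box 0 n 0 m\<close> and annihilated boxes shrunk to the common one.\<close>

lemma colvec_in_box:
  assumes "colvec (box a b c d) (box a' b' c' d') X"
    and "0 \<le> a" "b \<le> n" "0 \<le> c" "d \<le> m" "a' \<le> e" "f \<le> b'" "c' \<le> g" "h \<le> d'"
  shows "colvec (box 0 n 0 m) (box e f g h) X"
  using assms by (intro colvec_mono[OF assms(1)] box_mono box_D)

lemma Phi_in: "colvec (box 0 n 0 m) (box 0 (n - 1) 0 m) (Phi L n m)"
  and Phi_t_in: "colvec (box 0 n 0 m) (box 0 n 0 (m - 1)) (Phi_t L n m)"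
  and Phi_m1_in: "colvec (box 0 n 0 (m - 1)) (box 0 (n - 1) 0 (m - 1)) (Phi L n (m - 1))"
  and Phi_t_n1_in: "colvec (box 0 (n - 1) 0 m) (box 0 (n - 1) 0 (m - 1)) (Phi_t L (n - 1) m)"
  using n m by (auto intro: Phi_colvec Phi_t_colvec)

lemma on_Phi: "mip L (Phi L n m) (Phi L n m) = 1\<^sub>m (nat (m + 1))"
  and on_Phi_t: "mip L (Phi_t L n m) (Phi_t L n m) = 1\<^sub>m (nat (n + 1))"
  and on_Phi_m1: "mip L (Phi L n (m - 1)) (Phi L n (m - 1)) = 1\<^sub>m (nat m)"
  and on_Phi_t_n1: "mip L (Phi_t L (n - 1) m) (Phi_t L (n - 1) m) = 1\<^sub>m (nat n)"
  using n m Phi_orthonormal[of n "m - 1"] Phi_t_orthonormal[of m "n - 1"]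
  by (auto intro: Phi_orthonormal Phi_t_orthonormal)

lemma colrev_Phi_in: "colvec (box 0 n 0 m) (box 1 n 0 m) (colrev n m (Phi L n m))"
  using colvec_colrev[OF Phi_in, of n m] by (simp add: box_D)

lemma on_colrev_Phi: "mip L (colrev n m (Phi L n m)) (colrev n m (Phi L n m)) = 1\<^sub>m (nat (m + 1))"
  by (simp add: mip_colrev on_Phi)

lemma nat_dims: "nat (m + 1) = Suc (nat m)" "nat (n + 1) = Suc (nat n)"
  using n m by auto

text \<open>Expansion in the complement of \<open>box 0 (n - 1) 0 (m - 1)\<close>. The two basis
  vectors are orthogonal because Phi(n,m) annihilates \<open>box 0 (n - 1) 0 m\<close>, which
  supports the tilde vector.\<close>

lemma Gam_recurrence:
  "cmat (Gam_coef L n m) * Phi L n m = Phi L n (m - 1) - cmat (K_coef L n m) * Phi_t L (n - 1) m"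
proof (rule mat_add_eq_imp_diff[where a = "nat m" and b = 1])
  have "mip L (Phi L n m) (Phi_t L (n - 1) m) = 0\<^sub>m (nat (m + 1)) (nat n)"
    using mip_perp(1)[OF Phi_in Phi_t_n1_in] by simp
  then show "Phi L n (m - 1) = cmat (Gam_coef L n m) * Phi L n m + cmat (K_coef L n m) * Phi_t L (n - 1) m"
    unfolding Gam_coef_def K_coef_def
    by (intro mat_expansion(1)[of "box 0 (n - 1) 0 (m - 1)" "box 0 n 0 m"])
      (auto simp: box_D on_Phi on_Phi_t_n1 card_box nat_dims
        intro: box_mono colvec_in_box[OF Phi_in] colvec_in_box[OF Phi_m1_in] colvec_in_box[OF Phi_t_n1_in])
qed (simp_all add: Gam_coef_def K_coef_def carrier_matI)

text \<open>The same with \<open>box 0 (n - 1) 1 m\<close>: this is where multiplication by w moves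
  the box annihilated by Phi(n,m-1), and where reversal reflects the one annihilated by the tilde
  vector.\<close>

lemma Gam1_recurrence:
  "cmat (Gam1_coef L n m) * Phi L n m
    = wvar \<cdot>\<^sub>m Phi L n (m - 1) - cmat (K1_coef L n m) * (Phi_t_rev L (n - 1) m)\<^sup>T"
  unfolding Phi_rev_transpose
proof (rule mat_add_eq_imp_diff[where a = "nat m" and b = 1])
  have X: "colvec (box 0 n 1 m) (box 0 (n - 1) 1 m) (wvar \<cdot>\<^sub>m Phi L n (m - 1))"
    using colvec_shift[OF Phi_m1_in, of 0 1] by (simp add: box_D)
  have Y: "colvec (box 0 (n - 1) 0 m) (box 0 (n - 1) 1 m) (colrev (n - 1) m (Phi_t L (n - 1) m))"
    using colvec_colrev[OF Phi_t_n1_in, of "n - 1" m] by (simp add: box_D)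
  have "mip L (Phi L n m) (colrev (n - 1) m (Phi_t L (n - 1) m)) = 0\<^sub>m (nat (m + 1)) (nat n)"
    using mip_perp(1)[OF Phi_in Y] by simp
  then show "wvar \<cdot>\<^sub>m Phi L n (m - 1)
      = cmat (Gam1_coef L n m) * Phi L n m + cmat (K1_coef L n m) * colrev (n - 1) m (Phi_t L (n - 1) m)"
    unfolding Gam1_coef_def K1_coef_def Phi_rev_transpose
    by (intro mat_expansion(1)[of "box 0 (n - 1) 1 m" "box 0 n 0 m"])
      (auto simp: box_D on_Phi mip_colrev on_Phi_t_n1 card_box nat_dims
        intro: box_mono colvec_in_box[OF Phi_in] colvec_in_box[OF X] colvec_in_box[OF Y])
qed (simp_all add: Gam1_coef_def K1_coef_def Phi_rev_transpose carrier_matI)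

text \<open>The complement of \<open>Gam_recurrence\<close> again, in its other basis of n+1 and m
  elements. The coefficient of Phi(n,m-1) is the adjoint of \<open>Gam_coef\<close> by Hermitian
  symmetry.\<close>

lemma I_decomposition:
  "Phi L n m
    = cmat (I_coef L n m) * Phi_t L n m + cmat (mat_adjoint (Gam_coef L n m)) * Phi L n (m - 1)"
proof -
  have "mip L (Phi_t L n m) (Phi L n (m - 1)) = 0\<^sub>m (nat (n + 1)) (nat m)"
    using mip_perp(1)[OF Phi_t_in Phi_m1_in] by simp
  then have "Phi L n m = cmat (mip L (Phi L n m) (Phi_t L n m)) * Phi_t L n m
      + cmat (mip L (Phi L n m) (Phi L n (m - 1))) * Phi L n (m - 1)"
    by (intro mat_expansion(1)[of "box 0 (n - 1) 0 (m - 1)" "box 0 n 0 m"])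
      (auto simp: box_D on_Phi_t on_Phi_m1 card_box nat_dims
        intro: box_mono colvec_in_box[OF Phi_in] colvec_in_box[OF Phi_m1_in] colvec_in_box[OF Phi_t_in])
  then show ?thesis
    by (simp only: I_coef_def Gam_coef_def mip_adjoint[OF Phi_m1_in Phi_in])
qed

text \<open>The small box is now \<open>box 1 n 0 (m - 1)\<close>, which both reversed vectors and
  the tilde vector annihilate.\<close>

lemma I1_decomposition:
  "(Phi_rev L n m)\<^sup>T
    = cmat (I1_coef L n m) * Phi_t L n m + cmat ((Gam1_coef L n m)\<^sup>T) * (Phi_rev L n (m - 1))\<^sup>T"
proof -
  let ?Y = "colrev n (m - 1) (Phi L n (m - 1))"
  have Y: "colvec (box 0 n 0 (m - 1)) (box 1 n 0 (m - 1)) ?Y"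
    using colvec_colrev[OF Phi_m1_in, of n "m - 1"] by (simp add: box_D)
  have "mip L (Phi_t L n m) ?Y = 0\<^sub>m (nat (n + 1)) (nat m)"
    using mip_perp(1)[OF Phi_t_in Y] by simp
  then have "colrev n m (Phi L n m) = cmat (mip L (colrev n m (Phi L n m)) (Phi_t L n m)) * Phi_t L n m
      + cmat (mip L (colrev n m (Phi L n m)) ?Y) * ?Y"
    by (intro mat_expansion(1)[of "box 1 n 0 (m - 1)" "box 0 n 0 m"])
      (auto simp: box_D on_Phi_t mip_colrev on_Phi_m1 card_box nat_dims
        intro: box_mono colvec_in_box[OF colrev_Phi_in] colvec_in_box[OF Y] colvec_in_box[OF Phi_t_in])
  moreover have "mip L (colrev n m (Phi L n m)) ?Y = (Gam1_coef L n m)\<^sup>T"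
  proof (rule eq_matI; simp add: Gam1_coef_def)
    fix i j assume ij: "i < nat (m + 1)" "j < nat m"
    \<comment> \<open>Reversal of p in degree (n, m-1) equals reversal of w p in degree (n, m). With
      equal degrees \<open>ip_lrev\<close> applies and yields a transpose.\<close>
    have "?Y $$ (j, 0) = lrev n m (wvar * Phi L n (m - 1) $$ (j, 0))"
      using ij by (simp add: colrev_index lrev_def ldag_mult lmonom_mult flip: mult.assoc)
    then show "mip L (colrev n m (Phi L n m)) ?Y $$ (i, j)
        = mip L (wvar \<cdot>\<^sub>m Phi L n (m - 1)) (Phi L n m) $$ (j, i)"
      using ij by (simp add: mip_index colrev_index ip_lrev)
  qed
  ultimately show ?thesis
    by (simp only: Phi_rev_transpose I1_coef_def)
qed

section \<open>Recurrences in n and invertibility of the coefficient A\<close>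

context
  assumes n1: "1 \<le> n"
begin

lemma zPhi_in: "colvec (box 1 n 0 m) (box 1 (n - 1) 0 m) (zvar \<cdot>\<^sub>m Phi L (n - 1) m)"
  using colvec_shift[OF Phi_colvec, of "n - 1" m 1 0] n m n1 by (simp add: box_D)

lemma colrev_Phi_n1_in:
  "colvec (box 0 (n - 1) 0 m) (box 1 (n - 1) 0 m) (colrev (n - 1) m (Phi L (n - 1) m))"
  using colvec_colrev[OF Phi_colvec, of "n - 1" m "n - 1" m] n m n1 by (simp add: box_D)

lemma on_Phi_n1: "mip L (Phi L (n - 1) m) (Phi L (n - 1) m) = 1\<^sub>m (nat (m + 1))"
  using n m n1 by (intro Phi_orthonormal) auto

lemma E_hat_eq: "E_hat L n m = mip L (zvar \<cdot>\<^sub>m Phi L (n - 1) m) (colrev (n - 1) m (Phi L (n - 1) m))"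
  by (simp add: E_hat_def Phi_rev_transpose)

text \<open>Entry (i, j) is \<open>L\<close> applied to z^(2-n) w^(-m) times the product of rows i
  and j of Phi(n-1,m), and multiplication is commutative.\<close>

lemma E_hat_symmetric: "E_hat L n m = (E_hat L n m)\<^sup>T"
proof (rule eq_matI; simp add: E_hat_eq)
  fix i j assume "i < nat (m + 1)" "j < nat (m + 1)"
  then show "mip L (zvar \<cdot>\<^sub>m Phi L (n - 1) m) (colrev (n - 1) m (Phi L (n - 1) m)) $$ (i, j)
      = mip L (zvar \<cdot>\<^sub>m Phi L (n - 1) m) (colrev (n - 1) m (Phi L (n - 1) m)) $$ (j, i)"
    by (simp add: mip_index colrev_index ip_def lrev_def ldag_mult ac_simps)
qed

lemma cross_n1: "mip L (Phi L n m) (colrev (n - 1) m (Phi L (n - 1) m)) = 0\<^sub>m (nat (m + 1)) (nat (m + 1))"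
  using mip_perp(1)[OF Phi_in colrev_Phi_n1_in] by simp

lemma cross_zPhi:
  "mip L (zvar \<cdot>\<^sub>m Phi L (n - 1) m) (colrev n m (Phi L n m)) = 0\<^sub>m (nat (m + 1)) (nat (m + 1))"
  using mip_perp(2)[OF colrev_Phi_in zPhi_in] by simp

lemma card_n1: "nat (m + 1) + nat (m + 1) + card (box 1 (n - 1) 0 m) = card (box 0 n 0 m)"
proof -
  \<comment> \<open>The dimension count depends on n >= 1: for n = 0 truncation by
    \<open>nat\<close> would break this equation.\<close>
  have "nat (n + 1) = nat (n - 1) + 2"
    using n1 by simp
  then show ?thesis
    by (simp add: card_box)
qed

lemma zPhi_expansion:
  "zvar \<cdot>\<^sub>m Phi L (n - 1) m = cmat (A_coef L n m) * Phi L n m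
     + cmat (E_hat L n m) * colrev (n - 1) m (Phi L (n - 1) m)"
  unfolding A_coef_def E_hat_eq
  by (rule mat_expansion(1)[of "box 1 (n - 1) 0 m" "box 0 n 0 m"])
    (auto simp: box_D on_Phi mip_colrev on_Phi_n1 cross_n1 card_n1
      intro: box_mono colvec_in_box[OF Phi_in] colvec_in_box[OF zPhi_in] colvec_in_box[OF colrev_Phi_n1_in])

lemma A_recurrence:
  "cmat (A_coef L n m) * Phi L n m
    = zvar \<cdot>\<^sub>m Phi L (n - 1) m - cmat (E_hat L n m) * (Phi_rev L (n - 1) m)\<^sup>T"
  unfolding Phi_rev_transpose
  by (rule mat_add_eq_imp_diff[OF zPhi_expansion, where a = "nat (m + 1)" and b = 1])
    (simp_all add: A_coef_def E_hat_eq carrier_matI)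

lemma zPhi_orthonormal:
  "mip L (zvar \<cdot>\<^sub>m Phi L (n - 1) m) (zvar \<cdot>\<^sub>m Phi L (n - 1) m) = 1\<^sub>m (nat (m + 1))"
  by (simp add: mip_smult on_Phi_n1)

lemma A_carrier: "A_coef L n m \<in> carrier_mat (nat (m + 1)) (nat (m + 1))"
  and E_hat_carrier: "E_hat L n m \<in> carrier_mat (nat (m + 1)) (nat (m + 1))"
  by (simp_all add: A_coef_def E_hat_eq carrier_matI)

text \<open>Row j of z Phi(n-1,m) stays in \<open>lexset n m (m - int j)\<close>, and every phi with
  a larger last index annihilates that set.\<close>

lemma A_upper_triangular:
  assumes "i < j" "j < nat (m + 1)"
  shows "A_coef L n m $$ (j, i) = 0"
proof -
  have "ks (phi L (n - 1) m (m - int j)) \<subseteq> lexset (n - 1) m (m - int j)"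
    using assms n m n1 by (intro phi_facts) auto
  then have "ks (zvar * phi L (n - 1) m (m - int j)) \<subseteq> lexset n m (m - int j)"
    using assms by (force simp: keys_lmonom_mult lexset_def)
  then have "ip L (zvar * phi L (n - 1) m (m - int j)) (phi L n m (m - int i)) = 0"
    using assms n m n1 by (intro phi_orthogonal[of n "m - int j"]) auto
  then show ?thesis
    using assms by (simp add: A_coef_def mip_index) (simp add: Phi_def)
qed

text \<open>Compare coefficients of z^n w^(m-j) in row j of \<open>zPhi_expansion\<close>. The
  reversed vector has degree below n in z, the rows k < j drop out by triangularity, and the rows k
  > j lack the monomial. Only the diagonal term can produce the positive leading coefficient on the
  left.\<close>

lemma A_diag:
  assumes "j < nat (m + 1)"
  shows "A_coef L n m $$ (j, j) \<noteq> 0"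
proof
  assume 0: "A_coef L n m $$ (j, j) = 0"
  let ?X = "zvar \<cdot>\<^sub>m Phi L (n - 1) m" and ?Y = "colrev (n - 1) m (Phi L (n - 1) m)"
  have "A_coef L n m $$ (j, k) * lk (Phi L n m $$ (k, 0)) (n, m - int j) = 0"
    if k: "k < nat (m + 1)" for k
  proof (cases k j rule: linorder_cases)
    case less
    then show ?thesis
      using A_upper_triangular assms by simp
  next
    case greater
    have "ks (phi L n m (m - int k)) \<subseteq> lexset n m (m - int k)"
      using k n m by (intro phi_facts) auto
    then have "(n, m - int j) \<notin> ks (phi L n m (m - int k))"
      using greater by (auto simp: lexset_def)
    then show ?thesis
      using k by (simp add: Phi_def in_keys_iff)
  qed (simp add: 0)
  then have "lk ((cmat (A_coef L n m) * Phi L n m) $$ (j, 0)) (n, m - int j) = 0"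
    using assms A_carrier by (subst cmat_mult_index) (auto simp: lookup_sum intro!: sum.neutral)
  moreover have "lk ((cmat (E_hat L n m) * ?Y) $$ (j, 0)) (n, m - int j) = 0"
  proof -
    have "lk (?Y $$ (k, 0)) (n, m - int j) = 0" if "k < nat (m + 1)" for k
      using colvecD(4)[OF colrev_Phi_n1_in, of k] that by (auto simp: in_keys_iff)
    then show ?thesis
      using assms E_hat_carrier by (subst cmat_mult_index) (auto simp: lookup_sum)
  qed
  moreover have "?X $$ (j, 0)
      = (cmat (A_coef L n m) * Phi L n m) $$ (j, 0) + (cmat (E_hat L n m) * ?Y) $$ (j, 0)"
    using assms A_carrier E_hat_carrier by (subst zPhi_expansion) (simp del: index_mult_mat(1))
  ultimately have "lk (?X $$ (j, 0)) (n, m - int j) = 0"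
    by (simp add: lookup_add)
  moreover have "0 < lk (phi L (n - 1) m (m - int j)) (n - 1, m - int j)"
    using assms n m n1 by (intro phi_facts) auto
  ultimately show False
    using assms by (simp add: Phi_def)
qed

lemma det_A_transpose: "det ((A_coef L n m)\<^sup>T) \<noteq> 0"
proof -
  have "det (A_coef L n m) = prod_list (diag_mat (A_coef L n m))"
    using A_upper_triangular A_carrier by (intro det_upper_triangular) (auto intro: upper_triangularI)
  also have "\<dots> \<noteq> 0"
    using A_diag A_carrier by (auto simp: prod_list_zero_iff diag_mat_def)
  finally show ?thesis
    using A_carrier by (simp add: det_transpose)
qed

text \<open>Uses the second basis of the same complement. The coefficient of the reversed vector is
  identified afterwards, in \<open>colrev_coef\<close>.\<close>

lemma Phi_expansion:
  "Phi L n m = cmat (mat_adjoint (A_coef L n m)) * (zvar \<cdot>\<^sub>m Phi L (n - 1) m)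
    + cmat (mip L (Phi L n m) (colrev n m (Phi L n m))) * colrev n m (Phi L n m)"
  unfolding A_coef_def mip_adjoint[OF zPhi_in Phi_in, symmetric]
  by (rule mat_expansion(1)[of "box 1 (n - 1) 0 m" "box 0 n 0 m"])
    (auto simp: box_D on_colrev_Phi zPhi_orthonormal cross_zPhi card_n1
      intro: box_mono colvec_in_box[OF Phi_in] colvec_in_box[OF zPhi_in] colvec_in_box[OF colrev_Phi_in])

text \<open>
  This is Parseval's identity for \<open>0 = \<langle>\<Phi>\<^sub>n, \<Phi>\<^sub>n\<^sub>-\<^sub>1\<^sup>\<leftarrow>\<rangle>\<close> with respect to the
  orthonormal family formed by \<open>z\<Phi>\<^sub>n\<^sub>-\<^sub>1\<close> and \<open>\<Phi>\<^sub>n\<^sup>\<leftarrow>\<close>.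
\<close>

lemma colrev_coef:
  "mip L (Phi L n m) (colrev n m (Phi L n m)) * (A_coef L n m)\<^sup>T
    = - (mat_adjoint (A_coef L n m) * E_hat L n m)"
proof -
  let ?P = "Phi L n m" and ?R = "colrev n m (Phi L n m)" and ?Z = "zvar \<cdot>\<^sub>m Phi L (n - 1) m"
    and ?Y = "colrev (n - 1) m (Phi L (n - 1) m)" and ?k = "nat (m + 1)"
  have "mip L ?P ?Y = mip L ?P ?Z * mat_adjoint (mip L ?Y ?Z) + mip L ?P ?R * mat_adjoint (mip L ?Y ?R)"
    by (rule mat_expansion(2)[of "box 1 (n - 1) 0 m" "box 0 n 0 m"])
      (auto simp: box_D on_colrev_Phi zPhi_orthonormal cross_zPhi card_n1
        intro: box_mono colvec_in_box[OF Phi_in] colvec_in_box[OF zPhi_in]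
          colvec_in_box[OF colrev_Phi_in] colvec_in_box[OF colrev_Phi_n1_in])
  moreover have "mip L ?P ?Z = mat_adjoint (A_coef L n m)"
    unfolding A_coef_def by (rule mip_adjoint[OF zPhi_in Phi_in])
  moreover have "mat_adjoint (mip L ?Y ?Z) = E_hat L n m"
    unfolding E_hat_eq by (rule mip_adjoint[OF colrev_Phi_n1_in zPhi_in, symmetric])
  moreover have "mat_adjoint (mip L ?Y ?R) = (A_coef L n m)\<^sup>T"
    unfolding mip_adjoint[OF colrev_Phi_n1_in colrev_Phi_in, symmetric]
  proof (rule eq_matI; simp add: A_coef_def)
    fix i j assume ij: "i < ?k" "j < ?k"
    \<comment> \<open>Lowering the z-degree of the reversal by one is the same as multiplying by z
      before reversing in degree n.\<close>
    have "?Y $$ (j, 0) = lrev n m (?Z $$ (j, 0))"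
      using ij by (simp add: colrev_index lrev_def ldag_mult lmonom_mult flip: mult.assoc)
    then show "mip L ?R ?Y $$ (i, j) = mip L ?Z ?P $$ (j, i)"
      using ij by (simp add: mip_index colrev_index ip_lrev)
  qed
  ultimately have *: "0\<^sub>m ?k ?k = mat_adjoint (A_coef L n m) * E_hat L n m + mip L ?P ?R * (A_coef L n m)\<^sup>T"
    by (simp only: cross_n1)
  then show ?thesis
    using A_carrier E_hat_carrier by (intro mat_zero_eq_add[of ?k ?k]) auto
qed

lemma A_transpose_inverse:
  "(A_coef L n m)\<^sup>T * minv ((A_coef L n m)\<^sup>T) = 1\<^sub>m (nat (m + 1))"
  "minv ((A_coef L n m)\<^sup>T) * (A_coef L n m)\<^sup>T = 1\<^sub>m (nat (m + 1))"
  "minv ((A_coef L n m)\<^sup>T) \<in> carrier_mat (nat (m + 1)) (nat (m + 1))"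
proof -
  have c: "(A_coef L n m)\<^sup>T \<in> carrier_mat (nat (m + 1)) (nat (m + 1))"
    using A_carrier by simp
  then have "(A_coef L n m)\<^sup>T \<in> Units (ring_mat TYPE(complex) (nat (m + 1)) undefined)"
    using det_A_transpose by (rule det_non_zero_imp_unit)
  \<comment> \<open>A unit of the matrix ring rules out the result \<open>None\<close>, so
    \<open>minv\<close> denotes a genuine inverse.\<close>
  then obtain C where "mat_inverse ((A_coef L n m)\<^sup>T) = Some C"
    using mat_inverse(1)[OF c, of undefined] by (cases "mat_inverse ((A_coef L n m)\<^sup>T)") auto
  then show "(A_coef L n m)\<^sup>T * minv ((A_coef L n m)\<^sup>T) = 1\<^sub>m (nat (m + 1))"
    "minv ((A_coef L n m)\<^sup>T) * (A_coef L n m)\<^sup>T = 1\<^sub>m (nat (m + 1))"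
    "minv ((A_coef L n m)\<^sup>T) \<in> carrier_mat (nat (m + 1)) (nat (m + 1))"
    using mat_inverse(2)[OF c] by auto
qed

lemma invertible_A_transpose: "invertible_mat ((A_coef L n m)\<^sup>T)"
proof -
  have "square_mat ((A_coef L n m)\<^sup>T)"
    using A_carrier by auto
  moreover have "inverts_mat ((A_coef L n m)\<^sup>T) (minv ((A_coef L n m)\<^sup>T))"
    and "inverts_mat (minv ((A_coef L n m)\<^sup>T)) ((A_coef L n m)\<^sup>T)"
    using A_transpose_inverse A_carrier by (auto simp: inverts_mat_def)
  ultimately show ?thesis
    unfolding invertible_mat_def by blast
qed

lemma Phi_inverse_recurrence:
  "Phi L n m
      + cmat (mat_adjoint (A_coef L n m) * E_hat L n m * minv ((A_coef L n m)\<^sup>T)) * (Phi_rev L n m)\<^sup>T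
    = cmat (mat_adjoint (A_coef L n m)) * (zvar \<cdot>\<^sub>m Phi L (n - 1) m)"
proof -
  let ?k = "nat (m + 1)" and ?R = "colrev n m (Phi L n m)" and ?C = "minv ((A_coef L n m)\<^sup>T)"
    and ?X = "cmat (mat_adjoint (A_coef L n m)) * (zvar \<cdot>\<^sub>m Phi L (n - 1) m)"
  define B where "B = mip L (Phi L n m) ?R"
  have B: "B \<in> carrier_mat ?k ?k"
    by (simp add: B_def carrier_matI)
  have AE: "mat_adjoint (A_coef L n m) * E_hat L n m \<in> carrier_mat ?k ?k"
    using A_carrier E_hat_carrier by auto
  \<comment> \<open>Solving \<open>colrev_coef\<close> for the coefficient \<open>B\<close> by
    multiplying with the inverse on the right; moving the term with \<open>B\<close> across
    \<open>Phi_expansion\<close> gives the formula.\<close>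
  have "- (mat_adjoint (A_coef L n m) * E_hat L n m * ?C) = (B * (A_coef L n m)\<^sup>T) * ?C"
    unfolding colrev_coef[folded B_def] using AE A_transpose_inverse(3)
    by (subst uminus_mult_left_mat) auto
  also have "\<dots> = B"
    using B A_carrier A_transpose_inverse by simp
  finally have "mat_adjoint (A_coef L n m) * E_hat L n m * ?C = - B"
    by (metis uminus_uminus_mat)
  moreover have "cmat (- B) = - cmat B"
    by (rule eq_matI) (simp_all add: lconst_def single_uminus)
  ultimately have "cmat (mat_adjoint (A_coef L n m) * E_hat L n m * ?C) * ?R = - (cmat B * ?R)"
    using B by simp
  then have "Phi L n m + cmat (mat_adjoint (A_coef L n m) * E_hat L n m * ?C) * ?R
      = Phi L n m + - (cmat B * ?R)"
    by (rule arg_cong)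
  also have "\<dots> = ?X + cmat B * ?R + - (cmat B * ?R)"
    using Phi_expansion[folded B_def] by (rule arg_cong[where f = "\<lambda>Z. Z + - (cmat B * ?R)"])
  also have "\<dots> = ?X"
    using A_carrier B by (intro eq_matI) (auto simp del: index_mult_mat(1))
  finally show ?thesis
    unfolding Phi_rev_transpose .
qed

end

end

end

section \<open>The coefficient E and the matrix J\<close>

text \<open>Over an arbitrary semiring, so that it covers both \<open>J\<^sub>m\<close> and its lift to Laurent polynomials.\<close>

definition flip_mat :: "nat \<Rightarrow> 'a :: semiring_1 mat" where
  "flip_mat k = mat k k (\<lambda>(i, j). if i + j + 1 = k then 1 else 0)"

lemma flip_mat_dim [simp]: "dim_row (flip_mat k) = k" "dim_col (flip_mat k) = k"
  by (simp_all add: flip_mat_def)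

lemma mult_flip_mat:
  assumes "dim_col A = k" "i < dim_row A" "j < k"
  shows "(A * flip_mat k) $$ (i, j) = A $$ (i, k - 1 - j)"
proof -
  have "(A * flip_mat k) $$ (i, j) = (\<Sum>l < k. A $$ (i, l) * (if l + j + 1 = k then 1 else 0))"
    using assms by (simp add: flip_mat_def scalar_prod_def atLeast0LessThan)
  also have "\<dots> = (\<Sum>l < k. if l = k - 1 - j then A $$ (i, l) else 0)"
    using assms(3) by (intro sum.cong) auto
  finally show ?thesis
    using assms by simp
qed

lemma flip_mat_mult:
  assumes "dim_row A = k" "i < k" "j < dim_col A"
  shows "(flip_mat k * A) $$ (i, j) = A $$ (k - 1 - i, j)"
proof -
  have "(flip_mat k * A) $$ (i, j) = (\<Sum>l < k. (if i + l + 1 = k then 1 else 0) * A $$ (l, j))"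
    using assms by (simp add: flip_mat_def scalar_prod_def atLeast0LessThan)
  also have "\<dots> = (\<Sum>l < k. if l = k - 1 - i then A $$ (l, j) else 0)"
    using assms(2) by (intro sum.cong) auto
  finally show ?thesis
    using assms by simp
qed

lemma J_mat_eq: "J_mat m = flip_mat (nat (m + 1))"
  by (rule eq_matI) (auto simp: J_mat_def flip_mat_def)

lemma cmat_J_mat: "cmat (J_mat m) = flip_mat (nat (m + 1))"
  by (rule eq_matI) (auto simp: J_mat_eq flip_mat_def lconst_def simp flip: zero_prod_def)

lemma Lmat_dim [simp]: "dim_row (Lmat L n m) = nat (m + 1)" "dim_col (Lmat L n m) = nat (m + 1)"
  by (simp_all add: Lmat_def)

lemma v_col_dim [simp]: "dim_row (v_col m) = nat (m + 1)" "dim_col (v_col m) = 1"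
  by (simp_all add: v_col_def)

lemma Rmat_rev_dim [simp]:
  "dim_row (Rmat_rev L n m) = nat (m + 1)" "dim_col (Rmat_rev L n m) = nat (m + 1)"
  by (simp_all add: Rmat_rev_def Rmat_def mdag_def J_mat_def)

context pos_def_form
begin

text \<open>The double sum collects exactly the terms with exponents in \<open>box 0 n 0 m\<close>,
  and every entry of \<open>Phi\<close> is supported there.\<close>

lemma Lmat_v_col:
  assumes "0 \<le> n" "n \<le> int N" "m \<le> int M"
  shows "Lmat L n m * v_col m = Phi L n m"
proof (rule eq_matI)
  fix r j assume "r < dim_row (Phi L n m)" "j < dim_col (Phi L n m)"
  then have r: "r < nat (m + 1)" and j: "j = 0"
    by auto
  let ?p = "Phi L n m $$ (r, 0)"
  have "(Lmat L n m * v_col m) $$ (r, 0)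
      = (\<Sum>c < nat (m + 1). \<Sum>i = 0..n. lscale (lk ?p (i, m - int c)) (lmonom i 0) * lmonom 0 (m - int c))"
    using r by (simp add: scalar_prod_def Lmat_def v_col_def atLeast0LessThan sum_distrib_right)
  also have "\<dots> = (\<Sum>c < nat (m + 1). \<Sum>i = 0..n. lscale (lk ?p (i, m - int c)) (lmonom i (m - int c)))"
    by (simp add: lscale_def mult.assoc lmonom_mult)
  also have "\<dots> = (\<Sum>b = 0..m. \<Sum>i = 0..n. lscale (lk ?p (i, b)) (lmonom i b))"
    by (rule sum.reindex_bij_witness[of _ "\<lambda>b. nat (m - b)" "\<lambda>c. m - int c"]) auto
  also have "\<dots> = ?p"
  proof (rule poly_mapping_eqI)
    fix k :: "int \<times> int"
    obtain a b where k: "k = (a, b)"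
      by (cases k)
    have "lk (\<Sum>b = 0..m. \<Sum>i = 0..n. lscale (lk ?p (i, b)) (lmonom i b)) k
        = (\<Sum>b' = 0..m. \<Sum>i = 0..n. if i = a then (if b' = b then lk ?p (a, b) else 0) else 0)"
      unfolding lookup_sum by (intro sum.cong refl) (auto simp: lookup_lmonom k)
    also have "\<dots> = (if (a, b) \<in> box 0 n 0 m then lk ?p (a, b) else 0)"
      by (cases "0 \<le> a \<and> a \<le> n") auto
    also have "\<dots> = lk ?p k"
      using colvecD(4)[OF Phi_colvec[OF assms], of r] r by (auto simp: k in_keys_iff subset_iff)
    finally show "lk (\<Sum>b = 0..m. \<Sum>i = 0..n. lscale (lk ?p (i, b)) (lmonom i b)) k = lk ?p k" .
  qed
  finally show "(Lmat L n m * v_col m) $$ (r, j) = Phi L n m $$ (r, j)"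
    by (simp add: j)
qed simp_all

text \<open>Conjugation by J reverses both indices, and the transpose in \<open>Rmat\<close> cancels
  the one in the dagger. What remains is the reversed \<open>Phi\<close> with its rows in the
  opposite order, the origin of the factor J in \<open>E_hat_eq_E_coef\<close>.\<close>

lemma Rmat_rev_v_col:
  assumes "0 \<le> n" "n \<le> int N" "m \<le> int M" "r < nat (m + 1)"
  shows "(Rmat_rev L n m * v_col m) $$ (r, 0) = colrev n m (Phi L n m) $$ (nat (m + 1) - 1 - r, 0)"
proof -
  let ?k = "nat (m + 1)" and ?r = "nat (m + 1) - 1 - r"
  have R: "Rmat_rev L n m $$ (r, c) = lmonom n 0 * ldag (Lmat L n m $$ (?r, ?k - 1 - c))" if "c < ?k" for c
    using that assms(4)
    by (simp add: Rmat_rev_def Rmat_def mdag_def cmat_J_mat mult_flip_mat flip_mat_mult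
        del: index_mult_mat(1))
  have "(Rmat_rev L n m * v_col m) $$ (r, 0)
      = (\<Sum>c < ?k. lmonom n 0 * ldag (Lmat L n m $$ (?r, ?k - 1 - c)) * lmonom 0 (m - int c))"
    using assms(4) by (simp add: scalar_prod_def R v_col_def atLeast0LessThan)
  also have "\<dots> = (\<Sum>c < ?k. lmonom n 0 * ldag (Lmat L n m $$ (?r, c)) * lmonom 0 (int c))"
    \<comment> \<open>Since \<open>r\<close> indexes a row, m >= 0 and \<open>?k - 1\<close> is m;
      the substitution turns the power m - c of w into c.\<close>
    by (rule sum.reindex_bij_witness[of _ "\<lambda>c. ?k - 1 - c" "\<lambda>c. ?k - 1 - c"]) auto
  also have "\<dots> = (\<Sum>c < ?k. lrev n m (Lmat L n m $$ (?r, c) * lmonom 0 (m - int c)))"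
  proof (rule sum.cong)
    fix c
    have "lmonom n m * (x * lmonom 0 (int c - m)) = lmonom n 0 * x * lmonom 0 (int c)" for x
      using lmonom_mult[of n m 0 "int c - m"] lmonom_mult[of n 0 0 "int c"]
      by (simp add: ac_simps)
    then show "lmonom n 0 * ldag (Lmat L n m $$ (?r, c)) * lmonom 0 (int c)
        = lrev n m (Lmat L n m $$ (?r, c) * lmonom 0 (m - int c))"
      by (simp add: lrev_def ldag_mult)
  qed simp
  also have "\<dots> = lrev n m (\<Sum>c < ?k. Lmat L n m $$ (?r, c) * lmonom 0 (m - int c))"
  proof -
    have "lrev n m (\<Sum>c \<in> K. f c) = (\<Sum>c \<in> K. lrev n m (f c))" for f :: "nat \<Rightarrow> laurent" and K
      by (induction K rule: infinite_finite_induct) (simp_all add: lrev_def ldag_add distrib_left)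
    then show ?thesis
      by simp
  qed
  also have "(\<Sum>c < ?k. Lmat L n m $$ (?r, c) * lmonom 0 (m - int c)) = (Lmat L n m * v_col m) $$ (?r, 0)"
    using assms(4) by (simp add: scalar_prod_def v_col_def atLeast0LessThan)
  finally show ?thesis
    using assms by (simp add: Lmat_v_col colrev_index)
qed

lemma E_hat_eq_E_coef:
  assumes "1 \<le> n" "n \<le> int N" "m \<le> int M"
  shows "E_hat L n m = E_coef L n m * J_mat m"
proof (rule eq_matI)
  fix i j assume "i < dim_row (E_coef L n m * J_mat m)" "j < dim_col (E_coef L n m * J_mat m)"
  then have ij: "i < nat (m + 1)" "j < nat (m + 1)"
    by (auto simp: E_coef_def J_mat_eq)
  have "(E_coef L n m * J_mat m) $$ (i, j) = E_coef L n m $$ (i, nat (m + 1) - 1 - j)"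
    unfolding J_mat_eq using ij by (intro mult_flip_mat) (auto simp: E_coef_def)
  also have "\<dots> = E_hat L n m $$ (i, j)"
    using ij assms
    by (simp add: E_coef_def E_hat_def Phi_rev_transpose mip_index Lmat_v_col Rmat_rev_v_col
        del: index_mult_mat(1))
  finally show "E_hat L n m $$ (i, j) = (E_coef L n m * J_mat m) $$ (i, j)" ..
qed (simp_all add: E_coef_def E_hat_def Phi_rev_transpose J_mat_eq)

section \<open>Transfer to the reverse lexicographical ordering\<close>

lemma Phi_eq:
  assumes "0 \<le> n" "n \<le> int N" "m \<le> int M"
  shows "Phi L n m = map_mat lswap (Phi_t (L \<circ> lswap) m n)"
  using pos_def_form.Phi_t_eq[OF lswap_form assms] by (simp add: map_lswap_simps)

text \<open>The condition \<open>1 \<le> m\<close> goes with the coefficients containing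
  \<open>Phi_t L n (m - 1)\<close>, which \<open>Phi_t_eq\<close> covers only for a nonnegative
  second index.\<close>

lemma coef_t_eq:
  assumes "0 \<le> n" "n \<le> int N" "0 \<le> m" "m \<le> int M"
  shows "1 \<le> m \<Longrightarrow> A_coef_t L n m = A_coef (L \<circ> lswap) m n"
    and "1 \<le> m \<Longrightarrow> E_hat_t L n m = E_hat (L \<circ> lswap) m n"
    and "K_coef_t L n m = K_coef (L \<circ> lswap) m n"
    and "Gam_coef_t L n m = Gam_coef (L \<circ> lswap) m n"
    and "K1_coef_t L n m = K1_coef (L \<circ> lswap) m n"
    and "Gam1_coef_t L n m = Gam1_coef (L \<circ> lswap) m n"
    and "I_coef_t L n m = I_coef (L \<circ> lswap) m n"
    and "I1_coef_t L n m = I1_coef (L \<circ> lswap) m n"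
  unfolding A_coef_t_def E_hat_t_def K_coef_t_def Gam_coef_t_def K1_coef_t_def Gam1_coef_t_def
    I_coef_t_def I1_coef_t_def A_coef_def E_hat_def K_coef_def Gam_coef_def K1_coef_def Gam1_coef_def
    I_coef_def I1_coef_def Phi_rev_transpose
  using assms
  by (simp_all add: Phi_t_eq Phi_eq mip_lswap flip: map_lswap_simps(3) colrev_lswap)

end

theorem theorem3p5:
  fixes N M :: nat and L :: "laurent \<Rightarrow> complex" and n m :: int
  assumes "pos_def_functional N M L"
    and "0 \<le> n" "n \<le> int N" and "0 \<le> m" "m \<le> int M"
  shows
    "(1 \<le> n \<longrightarrow>
       cmat (A_coef L n m) * Phi L n m
         = zvar \<cdot>\<^sub>m Phi L (n - 1) m - cmat (E_hat L n m) * (Phi_rev L (n - 1) m)\<^sup>T) \<and>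
     (1 \<le> n \<longrightarrow>
       invertible_mat ((A_coef L n m)\<^sup>T) \<and>
       Phi L n m
           + cmat (mat_adjoint (A_coef L n m) * E_hat L n m * minv ((A_coef L n m)\<^sup>T)) * (Phi_rev L n m)\<^sup>T
         = cmat (mat_adjoint (A_coef L n m)) * (zvar \<cdot>\<^sub>m Phi L (n - 1) m)) \<and>
     (cmat (Gam_coef L n m) * Phi L n m
       = Phi L n (m - 1) - cmat (K_coef L n m) * Phi_t L (n - 1) m) \<and>
     (cmat (Gam1_coef L n m) * Phi L n m
       = wvar \<cdot>\<^sub>m Phi L n (m - 1) - cmat (K1_coef L n m) * (Phi_t_rev L (n - 1) m)\<^sup>T) \<and>
     (Phi L n m
       = cmat (I_coef L n m) * Phi_t L n m + cmat (mat_adjoint (Gam_coef L n m)) * Phi L n (m - 1)) \<and>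
     ((Phi_rev L n m)\<^sup>T
       = cmat (I1_coef L n m) * Phi_t L n m + cmat ((Gam1_coef L n m)\<^sup>T) * (Phi_rev L n (m - 1))\<^sup>T) \<and>
     (1 \<le> n \<longrightarrow> E_hat L n m = E_coef L n m * J_mat m) \<and>
     (1 \<le> n \<longrightarrow> E_hat L n m = (E_hat L n m)\<^sup>T) \<and>
     (1 \<le> n \<longrightarrow> E_hat L n m \<in> carrier_mat (nat (m + 1)) (nat (m + 1))) \<and>
     (1 \<le> n \<longrightarrow> A_coef L n m \<in> carrier_mat (nat (m + 1)) (nat (m + 1))) \<and>
     (K_coef L n m \<in> carrier_mat (nat m) (nat n)) \<and>
     (Gam_coef L n m \<in> carrier_mat (nat m) (nat (m + 1))) \<and>
     (K1_coef L n m \<in> carrier_mat (nat m) (nat n)) \<and>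
     (Gam1_coef L n m \<in> carrier_mat (nat m) (nat (m + 1))) \<and>
     (I_coef L n m \<in> carrier_mat (nat (m + 1)) (nat (n + 1))) \<and>
     (I1_coef L n m \<in> carrier_mat (nat (m + 1)) (nat (n + 1))) \<and>
     (1 \<le> m \<longrightarrow>
       cmat (A_coef_t L n m) * Phi_t L n m
         = wvar \<cdot>\<^sub>m Phi_t L n (m - 1) - cmat (E_hat_t L n m) * (Phi_t_rev L n (m - 1))\<^sup>T) \<and>
     (1 \<le> m \<longrightarrow>
       invertible_mat ((A_coef_t L n m)\<^sup>T) \<and>
       Phi_t L n m
           + cmat (mat_adjoint (A_coef_t L n m) * E_hat_t L n m * minv ((A_coef_t L n m)\<^sup>T))
             * (Phi_t_rev L n m)\<^sup>T
         = cmat (mat_adjoint (A_coef_t L n m)) * (wvar \<cdot>\<^sub>m Phi_t L n (m - 1))) \<and>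
     (cmat (Gam_coef_t L n m) * Phi_t L n m
       = Phi_t L (n - 1) m - cmat (K_coef_t L n m) * Phi L n (m - 1)) \<and>
     (cmat (Gam1_coef_t L n m) * Phi_t L n m
       = zvar \<cdot>\<^sub>m Phi_t L (n - 1) m - cmat (K1_coef_t L n m) * (Phi_rev L n (m - 1))\<^sup>T) \<and>
     (Phi_t L n m
       = cmat (I_coef_t L n m) * Phi L n m + cmat (mat_adjoint (Gam_coef_t L n m)) * Phi_t L (n - 1) m) \<and>
     ((Phi_t_rev L n m)\<^sup>T
       = cmat (I1_coef_t L n m) * Phi L n m + cmat ((Gam1_coef_t L n m)\<^sup>T) * (Phi_t_rev L (n - 1) m)\<^sup>T) \<and>
     (1 \<le> m \<longrightarrow> E_hat_t L n m = (E_hat_t L n m)\<^sup>T)"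
proof -
  interpret F: pos_def_form N M L
    using assms(1) by unfold_locales
  let ?L = "L \<circ> lswap" and ?sw = "map_mat lswap"
  interpret S: pos_def_form M N ?L
    by (rule F.lswap_form)
  \<comment> \<open>\<open>mn\<close> lists the bounds in the order of the interchanged form, where
    m is the first index; \<open>dims\<close> supplies the matrix sizes for
    \<open>map_lswap_mult\<close>.\<close>
  note nm = assms(2-5) and mn = assms(4,5,2,3)
  note dims = A_coef_def E_hat_def K_coef_def Gam_coef_def K1_coef_def Gam1_coef_def I_coef_def I1_coef_def
  have t: "Phi_t L n m = ?sw (Phi ?L m n)" "Phi_t L (n - 1) m = ?sw (Phi ?L m (n - 1))"
    "1 \<le> m \<Longrightarrow> Phi_t L n (m - 1) = ?sw (Phi ?L (m - 1) n)"
    using nm by (simp_all add: F.Phi_t_eq)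
  have p: "Phi L n m = ?sw (Phi_t ?L m n)" "Phi L n (m - 1) = ?sw (Phi_t ?L (m - 1) n)"
    using nm by (simp_all add: F.Phi_eq)
  note coef = F.coef_t_eq[OF nm] and rev = Phi_rev_transpose
  have 1: "cmat (A_coef_t L n m) * Phi_t L n m
      = wvar \<cdot>\<^sub>m Phi_t L n (m - 1) - cmat (E_hat_t L n m) * (Phi_t_rev L n (m - 1))\<^sup>T" if "1 \<le> m"
    \<comment> \<open>The formula for \<open>?L\<close> with n and m exchanged is mapped through the
      interchange of variables; constant matrices are unaffected.\<close>
    using arg_cong[OF S.A_recurrence[OF mn that], of ?sw]
    by (simp add: rev t that coef map_lswap_mult map_lswap_simps colrev_lswap dims)
  have 2: "invertible_mat ((A_coef_t L n m)\<^sup>T) \<and> Phi_t L n m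
        + cmat (mat_adjoint (A_coef_t L n m) * E_hat_t L n m * minv ((A_coef_t L n m)\<^sup>T))
          * (Phi_t_rev L n m)\<^sup>T
      = cmat (mat_adjoint (A_coef_t L n m)) * (wvar \<cdot>\<^sub>m Phi_t L n (m - 1))" if "1 \<le> m"
  proof -
    \<comment> \<open>The size of the inverse is not visible from its definition and is needed to
      move the interchange through the product.\<close>
    have "dim_col (minv ((A_coef ?L m n)\<^sup>T)) = nat (n + 1)"
      using S.A_transpose_inverse(3)[OF mn that] by simp
    moreover have "dim_row (A_coef ?L m n) = nat (n + 1)" "dim_col (A_coef ?L m n) = nat (n + 1)"
      by (simp_all add: A_coef_def)
    ultimately show ?thesis
      using S.invertible_A_transpose[OF mn that] arg_cong[OF S.Phi_inverse_recurrence[OF mn that], of ?sw]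
      by (simp add: rev t that coef map_lswap_mult map_lswap_simps colrev_lswap)
  qed
  have 3: "cmat (Gam_coef_t L n m) * Phi_t L n m
      = Phi_t L (n - 1) m - cmat (K_coef_t L n m) * Phi L n (m - 1)"
    using arg_cong[OF S.Gam_recurrence[OF mn], of ?sw]
    by (simp add: t p coef map_lswap_mult map_lswap_simps dims)
  have 4: "cmat (Gam1_coef_t L n m) * Phi_t L n m
      = zvar \<cdot>\<^sub>m Phi_t L (n - 1) m - cmat (K1_coef_t L n m) * (Phi_rev L n (m - 1))\<^sup>T"
    using arg_cong[OF S.Gam1_recurrence[OF mn], of ?sw]
    by (simp add: rev t p coef map_lswap_mult map_lswap_simps colrev_lswap dims)
  have 5: "Phi_t L n m
      = cmat (I_coef_t L n m) * Phi L n m + cmat (mat_adjoint (Gam_coef_t L n m)) * Phi_t L (n - 1) m"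
    using arg_cong[OF S.I_decomposition[OF mn], of ?sw]
    by (simp add: t p coef map_lswap_mult map_lswap_simps dims)
  have 6: "(Phi_t_rev L n m)\<^sup>T
      = cmat (I1_coef_t L n m) * Phi L n m + cmat ((Gam1_coef_t L n m)\<^sup>T) * (Phi_t_rev L (n - 1) m)\<^sup>T"
    using arg_cong[OF S.I1_decomposition[OF mn], of ?sw]
    by (simp add: rev t p coef map_lswap_mult map_lswap_simps colrev_lswap dims)
  have 7: "E_hat_t L n m = (E_hat_t L n m)\<^sup>T" if "1 \<le> m"
    using S.E_hat_symmetric[OF mn that] by (simp add: coef that)
  have carrier: "K_coef L n m \<in> carrier_mat (nat m) (nat n)"
    "Gam_coef L n m \<in> carrier_mat (nat m) (nat (m + 1))"
    "K1_coef L n m \<in> carrier_mat (nat m) (nat n)"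
    "Gam1_coef L n m \<in> carrier_mat (nat m) (nat (m + 1))"
    "I_coef L n m \<in> carrier_mat (nat (m + 1)) (nat (n + 1))"
    "I1_coef L n m \<in> carrier_mat (nat (m + 1)) (nat (n + 1))"
    by (rule carrier_matI; simp add: dims rev)+
  show ?thesis
    by (intro conjI impI F.A_recurrence[OF nm] F.invertible_A_transpose[OF nm]
        F.Phi_inverse_recurrence[OF nm] F.Gam_recurrence[OF nm] F.Gam1_recurrence[OF nm]
        F.I_decomposition[OF nm] F.I1_decomposition[OF nm] F.E_hat_eq_E_coef F.E_hat_symmetric[OF nm]
        F.E_hat_carrier[OF nm] F.A_carrier[OF nm] carrier 1 2[THEN conjunct1] 2[THEN conjunct2]
        3 4 5 6 7 assms)
qed

end
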